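(* Let $d\ge2$, $\rho=\frac{d-1}{2}$, and let $E_\lambda$ be the Fourier extension operator on $\mathbb{H}^d$ (defined in the context), $p,q\in[1,\infty]$. (i) For $\lambda>0$, the operator $E_\lambda$ is not bounded from $L^p(\mathbb{S}^{d-1})$ to $L^q(\mathbb{H}^d)$ if $p<2$ or $q\le2$. (ii) If $p\ge2$ and $q>2$, then for $\lambda>1$ the operator norm of $E_\lambda$ satisfies $$\|E_\lambda\|_{L^p(\mathbb{S}^{d-1})\to L^q(\mathbb{H}^d)}\gtrsim (q-2)^{-1/2}\lambda^{\frac\rho p-\frac\rho q}+\lambda^{\rho-\frac dq}.$$
   Context: $A\gtrsim B$ means $A\ge cB$ with $c>0$ depending only on $d$; $(\infty-2)^{-1/2}$ is read as $0$. Hyperbolic space: $[x,y]=x^0y^0-x^1y^1-\dots-x^dy^d$ on $\mathbb{R}^{d+1}$, and $\mathbb{H}^d=\{x\in\mathbb{R}^{d+1}:[x,x]=1,\ x^0>0\}$ with the Riemannian metric induced by the Minkowski metric and the corresponding measure $dx$. For $\lambda>0$, $\omega\in\mathbb{S}^{d-1}$, $h_{\lambda,\omega}(x)=[x,(1,\omega)]^{i\lambda-\rho}$. The Harish-Chandra function is $\mathbf{c}(\lambda)=\frac{2^{2\rho-1}\Gamma(\rho+\frac12)}{\pi^{1/2}}\frac{\Gamma(i\lambda)}{\Gamma(\rho+i\lambda)}$. With $\omega_{d-1}$ the total measure of $\mathbb{S}^{d-1}$, the Fourier extension operator maps functions on $\mathbb{S}^{d-1}$ to functions on $\mathbb{H}^d$: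 $$[E_\lambda f](x)=|\mathbf{c}(\lambda)|^{-1}\frac{1}{\omega_{d-1}}\int_{\mathbb{S}^{d-1}}f(\omega)\,\overline{h_{\lambda,\omega}(x)}\,d\omega .$$ *)

theory Defs
  imports "HOL-Analysis.Analysis" "HOL-Probability.Essential_Supremum"
begin

section \<open>Lebesgue spaces and operators between them\<close>

text \<open>
  Exponents range over \<open>[1, \<infinity>]\<close> and are elements of \<^typ>\<open>ennreal\<close>. \<open>rec_exp p\<close> is the real
  number \<open>1/p\<close>, with \<open>1/\<infinity> = 0\<close>.
\<close>

definition rec_exp :: "ennreal \<Rightarrow> real" where
  "rec_exp p = enn2real (inverse p)"

definition Lp_norm :: "ennreal \<Rightarrow> 'a measure \<Rightarrow> ('a \<Rightarrow> complex) \<Rightarrow> ennreal" where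
  "Lp_norm p M f =
     (if p = \<infinity> then esssup M (\<lambda>x. ennreal (cmod (f x)))
      else let I = (\<integral>\<^sup>+ x. ennreal (cmod (f x) powr enn2real p) \<partial>M)
           in if I = \<infinity> then \<infinity> else ennreal (enn2real I powr rec_exp p))"

definition Lp_space :: "ennreal \<Rightarrow> 'a measure \<Rightarrow> ('a \<Rightarrow> complex) set" where
  "Lp_space p M = {f \<in> borel_measurable M. Lp_norm p M f < \<infinity>}"

definition Lp_bounded ::
  "ennreal \<Rightarrow> ennreal \<Rightarrow> 'a measure \<Rightarrow> 'b measure \<Rightarrow> (('a \<Rightarrow> complex) \<Rightarrow> ('b \<Rightarrow> complex)) \<Rightarrow> bool"
  where
  "Lp_bounded p q M N T \<longleftrightarrow>
     (\<exists>C::real. \<forall>f \<in> Lp_space p M.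
        T f \<in> Lp_space q N \<and> Lp_norm q N (T f) \<le> ennreal C * Lp_norm p M f)"

definition Lp_opnorm ::
  "ennreal \<Rightarrow> ennreal \<Rightarrow> 'a measure \<Rightarrow> 'b measure \<Rightarrow> (('a \<Rightarrow> complex) \<Rightarrow> ('b \<Rightarrow> complex)) \<Rightarrow> ennreal"
  where
  "Lp_opnorm p q M N T = (SUP f \<in> {f \<in> Lp_space p M. Lp_norm p M f \<le> 1}. Lp_norm q N (T f))"


section \<open>The unit sphere\<close>

text \<open>
  The surface measure given by polar coordinates:
  \<open>\<sigma> A = d \<cdot> vol {x. 0 < \<bar>x\<bar> \<le> 1 \<and> x/\<bar>x\<bar> \<in> A}\<close> for Borel \<open>A\<close> in the sphere of \<open>\<real>\<^sup>d\<close>.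
\<close>

definition sphere_measure :: "(real ^ 'n) measure" where
  "sphere_measure =
     scale_measure (of_nat CARD('n))
       (distr (restrict_space lborel (cball 0 1 - {0})) (restrict_space borel (sphere 0 1))
          (\<lambda>x. x /\<^sub>R norm x))"


section \<open>Hyperbolic space\<close>

definition mink :: "real \<times> (real ^ 'n) \<Rightarrow> real \<times> (real ^ 'n) \<Rightarrow> real" where
  "mink x y = fst x * fst y - (\<Sum>i\<in>UNIV. snd x $ i * snd y $ i)"

definition hyp_space :: "(real \<times> (real ^ 'n)) set" where
  "hyp_space = {x. mink x x = 1 \<and> fst x > 0}"

text \<open>
  The Riemannian measure is defined through the global chart \<open>\<real>\<^sup>d \<rightarrow> \<bbbH>\<^sup>d\<close> as
  \<open>\<surd>(det g) dv\<close>. Since \<open>mink\<close> has signature \<open>(+,-,\<dots>,-)\<close>, the metric it induces on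
  the tangent spaces of \<open>\<bbbH>\<^sup>d\<close> is negative definite; \<open>g\<close> is its negative.
\<close>

definition hyp_chart :: "real ^ 'n \<Rightarrow> real \<times> (real ^ 'n)" where
  "hyp_chart v = (sqrt (1 + (norm v)\<^sup>2), v)"

definition hyp_metric :: "real ^ 'n \<Rightarrow> real ^ 'n ^ 'n" where
  "hyp_metric v =
     (\<chi> i j. - mink (frechet_derivative hyp_chart (at v) (axis i 1))
                     (frechet_derivative hyp_chart (at v) (axis j 1)))"

definition hyp_measure :: "(real \<times> (real ^ 'n)) measure" where
  "hyp_measure =
     distr (density lborel (\<lambda>v. ennreal (sqrt (det (hyp_metric v)))))
       (restrict_space borel hyp_space) hyp_chart"


section \<open>The Fourier extension operator\<close>

definition rho :: "nat \<Rightarrow> real" where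
  "rho d = (real d - 1) / 2"

definition harish_chandra_c :: "nat \<Rightarrow> real \<Rightarrow> complex" where
  "harish_chandra_c d l =
     of_real (2 powr (2 * rho d - 1) * Gamma (rho d + 1/2) / pi powr (1/2))
     * (Gamma (\<i> * of_real l) / Gamma (of_real (rho d) + \<i> * of_real l))"

definition hyp_wave :: "real \<Rightarrow> real ^ 'n \<Rightarrow> real \<times> (real ^ 'n) \<Rightarrow> complex" where
  "hyp_wave l w x = of_real (mink x (1, w)) powr (\<i> * of_real l - of_real (rho CARD('n)))"

definition fourier_ext ::
  "real \<Rightarrow> (real ^ 'n \<Rightarrow> complex) \<Rightarrow> (real \<times> (real ^ 'n) \<Rightarrow> complex)" where
  "fourier_ext l f x =
     of_real (inverse (cmod (harish_chandra_c CARD('n) l)))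
     * of_real (1 / measure (sphere_measure :: (real ^ 'n) measure) (sphere 0 1))
     * (LINT w | sphere_measure. f w * cnj (hyp_wave l w x))"

end

theory Submission
  imports Defs
begin

text \<open>
  All the bounds come from testing the operator on indicators \<open>f = a \<cdot> 1\<^sub>S\<close> at points where the
  defining integral has no cancellation. In the chart \<open>v\<close> the kernel is
  \<open>t powr - \<rho> \<cdot> cis (- \<lambda> ln t)\<close> with \<open>t = sqrt (1 + \<bar>v\<bar>\<^sup>2) - v \<bullet> \<omega> > 0\<close>. If \<open>\<lambda> ln t\<close> varies by at
  most one radian while \<open>\<omega>\<close> runs through \<open>S\<close>, then the absolute value of the extension is at least
  half of \<open>a \<sigma>(S) min t powr - \<rho>\<close>, up to the factor \<open>\<bar>c(\<lambda>)\<bar>\<^sup>-\<^sup>1\<close> and the mass of the sphere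
  (\<open>fourier_ext_indicator_ge\<close>). By the recursion and the reflection formula for the Gamma function
  this factor \<open>\<bar>c(\<lambda>)\<bar>\<^sup>-\<^sup>1\<close> is at least a multiple of \<open>\<lambda> powr \<rho>\<close> for \<open>\<lambda> \<ge> 1\<close>
  (\<open>inverse_harish_chandra_c_lower\<close>).

  Three choices of \<open>S\<close> and of a region for \<open>v\<close> give the result.

  \<^item> A cap of radius comparable to \<open>(1 + \<lambda>) powr (- 1 / 2)\<close>, seen from the opposite side: for \<open>- v\<close> in
    the cone over the cap, \<open>t\<close> is almost its maximum \<open>sqrt (1 + \<bar>v\<bar>\<^sup>2) + \<bar>v\<bar>\<close>, so the phase is
    constant up to a bounded error, for arbitrarily large \<open>\<bar>v\<bar>\<close>. The extension therefore decays
    no faster than \<open>\<bar>v\<bar> powr - \<rho>\<close> along a cone of infinite extent. As volume grows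
    like \<open>\<bar>v\<bar> powr (2 * \<rho>)\<close> over dyadic shells, the \<open>L\<^sup>q\<close> norm is infinite for \<open>q \<le> 2\<close>, and
    for \<open>q > 2\<close> a geometric series with ratio \<open>2 powr (\<rho> (2 - q))\<close> produces the factor
    \<open>(q - 2) powr (- 1 / 2)\<close> (\<open>nn_integral_fourier_ext_cap_ge\<close>).

  \<^item> A cap of radius comparable to \<open>1 / R\<close>, seen from points above it with \<open>\<bar>v\<bar>\<close> of order \<open>R\<close>, where
    the kernel is concentrated: there \<open>t\<close> is of order \<open>1 / R\<close>, the region has volume bounded below,
    and comparison with \<open>\<parallel>f\<parallel>\<^sub>p\<close> gives a ratio of order \<open>R powr (\<rho> (2 / p - 1))\<close>, which is
    unbounded for \<open>p < 2\<close> (\<open>not_Lp_bounded_of_p_less_2\<close>).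

  \<^item> The whole sphere, seen from points with \<open>\<bar>v\<bar>\<close> of order \<open>1 / \<lambda>\<close>, where \<open>t\<close> is close to \<open>1\<close>: the
    extension is of order \<open>\<lambda> powr \<rho>\<close> on a set of volume of order \<open>\<lambda> powr - d\<close>
    (\<open>opnorm_fourier_ext_constant_lower\<close>).

  Caps are cut out by cones and regions of hyperbolic space are boxes in the chart, so that the only
  volumes involved are those of coordinate boxes. Only lower bounds for them enter: the
  normalisation of \<open>f\<close> leaves the power \<open>1 - 1/p \<ge> 0\<close> of \<open>\<sigma>(S)\<close>.
\<close>

section \<open>The size of the Harish-Chandra function\<close>

lemma not_nonpos_Int_of_Im:
  assumes "Im z \<noteq> 0"
  shows "z \<notin> \<int>\<^sub>\<le>\<^sub>0"
  using assms by (auto elim!: nonpos_Ints_cases)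

text \<open>
  The reflection formula for \<open>z\<close> and \<open>1 - z\<close>: on the imaginary axis \<open>\<Gamma> (1 - z) = - z \<Gamma> (- z)\<close>
  and \<open>\<Gamma> (- z)\<close> is the conjugate of \<open>\<Gamma> z\<close>. On the line of real part \<open>1/2\<close>, used next,
  \<open>1 - z\<close> is itself the conjugate of \<open>z\<close>.
\<close>

lemma norm_Gamma_imaginary:
  assumes "l > 0"
  shows "(cmod (Gamma (\<i> * of_real l)))\<^sup>2 * l = pi / sinh (pi * l)"
proof -
  let ?z = "\<i> * of_real l :: complex"
  have "- ?z \<notin> \<int>\<^sub>\<le>\<^sub>0"
    using assms by (simp add: not_nonpos_Int_of_Im)
  hence "Gamma (1 - ?z) = - ?z * Gamma (- ?z)"
    using Gamma_plus1[of "- ?z"] by (simp add: add.commute)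
  also have "Gamma (- ?z) = cnj (Gamma ?z)"
    by (simp add: cnj_Gamma)
  finally have "Gamma (1 - ?z) = - ?z * cnj (Gamma ?z)" .
  hence "Gamma ?z * (- ?z * cnj (Gamma ?z)) = of_real pi / sin (of_real pi * ?z)"
    using Gamma_reflection_complex[of ?z] by simp
  hence refl: "cmod (Gamma ?z * (- ?z * cnj (Gamma ?z))) = cmod (of_real pi / sin (of_real pi * ?z))"
    by simp
  have "of_real pi * ?z = \<i> * of_real (pi * l)" by simp
  moreover have "sin (\<i> * of_real x) = \<i> * of_real (sinh x)" for x
    by (simp add: sin_i_times sinh_field_def exp_of_real exp_minus)
  ultimately have "sin (of_real pi * ?z) = \<i> * of_real (sinh (pi * l))"
    by metis
  hence "cmod (sin (of_real pi * ?z)) = sinh (pi * l)"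
    using assms by (simp add: norm_mult)
  with refl show ?thesis
    using assms by (simp add: norm_mult norm_divide power2_eq_square mult_ac)
qed

lemma norm_Gamma_half_plus_imaginary:
  "(cmod (Gamma (1/2 + \<i> * of_real l)))\<^sup>2 = pi / cosh (pi * l)"
proof -
  let ?z = "1/2 + \<i> * of_real l :: complex"
  have "1 - ?z = cnj ?z"
    by (simp add: complex_eq_iff)
  hence "Gamma ?z * cnj (Gamma ?z) = of_real pi / sin (of_real pi * ?z)"
    using Gamma_reflection_complex[of ?z] by (simp only: cnj_Gamma)
  hence "cmod (Gamma ?z * cnj (Gamma ?z)) = cmod (of_real pi / sin (of_real pi * ?z))"
    by simp
  moreover have "sin (of_real pi * ?z) = of_real (cosh (pi * l))"
  proof -
    have "of_real pi * ?z = of_real (pi / 2) + \<i> * of_real (pi * l)"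
      by (simp add: algebra_simps)
    also have "sin \<dots> = cos (\<i> * of_real (pi * l))"
      unfolding sin_add by (simp add: sin_of_real cos_of_real del: of_real_divide of_real_mult)
    also have "\<dots> = of_real (cosh (pi * l))"
      by (simp add: cos_i_times cosh_field_def exp_of_real exp_minus del: of_real_mult)
    finally show ?thesis .
  qed
  ultimately show ?thesis
    by (simp add: norm_mult norm_divide power2_eq_square)
qed

text \<open>
  A step from \<open>n\<close> to \<open>n + 2\<close> multiplies the left side by \<open>\<bar>n/2 + \<i> l\<bar> \<ge> l\<close>; the start \<open>n = 1\<close> of the odd
  chain compares the two exact values above, whose quotient is \<open>l tanh (\<pi> l)\<close>.
\<close>

lemma norm_Gamma_ratio_lower:
  assumes l: "l \<ge> 1"
  shows "cmod (Gamma (of_real (real n / 2) + \<i> * of_real l))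
           \<ge> l powr (real n / 2) / 2 * cmod (Gamma (\<i> * of_real l))"
proof (induction n rule: induct_nat_012)
  case 0
  show ?case using l by simp
next
  case 1
  have pl: "pi * l \<ge> 1"
    using l pi_gt3 mult_mono[of 1 pi 1 l] by simp
  \<comment> \<open>\<open>tanh (\<pi> l) \<ge> 1/2\<close>, since \<open>exp (2 \<pi> l) \<ge> 3\<close>\<close>
  have "exp (2 * (pi * l)) \<ge> 1 + 2 * (pi * l)"
    by (rule exp_ge_add_one_self)
  hence e: "exp (2 * (pi * l)) \<ge> 3" using pl by linarith
  have "exp (pi * l) \<ge> 3 * exp (- (pi * l))"
    using e by (simp add: exp_minus field_simps flip: exp_add)
  hence cs: "cosh (pi * l) \<le> 2 * sinh (pi * l)"
    by (simp add: cosh_field_def sinh_field_def)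
  have sp: "sinh (pi * l) > 0" using pl by simp
  have "(sqrt l / 2 * cmod (Gamma (\<i> * of_real l)))\<^sup>2 = (cmod (Gamma (\<i> * of_real l)))\<^sup>2 * l / 4"
    using l by (simp add: power_mult_distrib power_divide)
  also have "\<dots> = pi / (4 * sinh (pi * l))"
    using norm_Gamma_imaginary[of l] l by simp
  also have "\<dots> \<le> pi / cosh (pi * l)"
    using order.trans[OF cs, of "4 * sinh (pi * l)"] sp cosh_real_pos[of "pi * l"] by (intro divide_left_mono mult_pos_pos) auto
  also have "\<dots> = (cmod (Gamma (1/2 + \<i> * of_real l)))\<^sup>2"
    by (simp add: norm_Gamma_half_plus_imaginary)
  finally have "sqrt l / 2 * cmod (Gamma (\<i> * of_real l)) \<le> cmod (Gamma (1/2 + \<i> * of_real l))"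
    by (rule power2_le_imp_le) simp
  thus ?case using l by (simp add: powr_half_sqrt)
next
  case (ge2 n)
  let ?z = "of_real (real n / 2) + \<i> * of_real l :: complex"
  have "?z \<notin> \<int>\<^sub>\<le>\<^sub>0"
    using l by (simp add: not_nonpos_Int_of_Im)
  hence "cmod (Gamma (?z + 1)) = cmod ?z * cmod (Gamma ?z)"
    by (simp add: Gamma_plus1 norm_mult)
  moreover have "cmod ?z \<ge> l"
    using abs_Im_le_cmod[of ?z] l by simp
  ultimately have "cmod (Gamma (?z + 1)) \<ge> l * (l powr (real n / 2) / 2 * cmod (Gamma (\<i> * of_real l)))"
    using mult_mono[OF _ ge2(1), of l "cmod ?z"] l by simp
  moreover have "l * l powr (real n / 2) = l powr (real (Suc (Suc n)) / 2)"
    using l by (simp add: add_divide_distrib powr_add)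
  moreover have "?z + 1 = of_real (real (Suc (Suc n)) / 2) + \<i> * of_real l"
    by (simp add: field_simps)
  ultimately show ?case by (simp only: mult.assoc[symmetric] times_divide_eq_right)
qed

lemma inverse_harish_chandra_c_pos:
  assumes "l > 0" "d \<ge> 1"
  shows "inverse (cmod (harish_chandra_c d l)) > 0"
proof -
  have r: "rho d \<ge> 0" using assms by (simp add: rho_def)
  have "Gamma (\<i> * complex_of_real l) \<noteq> 0" "Gamma (complex_of_real (rho d) + \<i> * of_real l) \<noteq> 0"
    using assms by (auto simp: Gamma_eq_zero_iff not_nonpos_Int_of_Im)
  moreover have "Gamma (rho d + 1/2) \<noteq> 0"
    using r Gamma_real_pos[of "rho d + 1/2"] by (metis add_nonneg_pos half_gt_zero less_irrefl zero_less_one)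
  ultimately show ?thesis
    by (simp add: harish_chandra_c_def)
qed

lemma inverse_harish_chandra_c_lower:
  assumes d: "d \<ge> 1"
  shows "\<exists>C>0. \<forall>l\<ge>1. inverse (cmod (harish_chandra_c d l)) \<ge> C * l powr rho d"
proof -
  define K where "K = 2 powr (2 * rho d - 1) * Gamma (rho d + 1/2) / pi powr (1/2)"
  have r: "rho d = real (d - 1) / 2" using d by (simp add: rho_def)
  have "Gamma (rho d + 1/2) > 0"
    by (intro Gamma_real_pos) (simp add: r add_nonneg_pos)
  hence K: "K > 0" by (simp add: K_def)
  have "inverse (cmod (harish_chandra_c d l)) \<ge> inverse (2 * K) * l powr rho d" if l: "l \<ge> 1" for l
  proof -
  let ?G0 = "cmod (Gamma (\<i> * complex_of_real l))"
  let ?G1 = "cmod (Gamma (complex_of_real (rho d) + \<i> * of_real l))"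
  have G0: "?G0 > 0"
    using l by (auto simp: Gamma_eq_zero_iff not_nonpos_Int_of_Im)
  have "inverse (cmod (harish_chandra_c d l)) = inverse K * (?G1 / ?G0)"
  proof -
    have "harish_chandra_c d l =
        of_real K * (Gamma (\<i> * of_real l) / Gamma (of_real (rho d) + \<i> * of_real l))"
      by (simp only: harish_chandra_c_def K_def)
    thus ?thesis
      using K by (simp add: norm_mult norm_divide field_simps)
  qed
  moreover have "?G1 / ?G0 \<ge> l powr rho d / 2"
    using norm_Gamma_ratio_lower[OF l, of "d - 1"] G0 unfolding r by (simp add: field_simps)
  ultimately have "inverse (cmod (harish_chandra_c d l)) \<ge> inverse K * (l powr rho d / 2)"
    using K mult_left_mono[of "l powr rho d / 2" "?G1 / ?G0" "inverse K"] by simp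
  thus ?thesis
    by simp
  qed
  thus ?thesis using K by (intro exI[of _ "inverse (2 * K)"]) auto
qed

section \<open>The Riemannian measure in the chart\<close>

lemma has_derivative_hyp_chart:
  fixes v :: "real ^ 'n"
  shows "(hyp_chart has_derivative (\<lambda>h. (v \<bullet> h / sqrt (1 + (norm v)\<^sup>2), h))) (at v)"
proof -
  have p: "1 + v \<bullet> v > 0" by (simp add: add_pos_nonneg)
  have "((\<lambda>v::real^'n. (sqrt (1 + v \<bullet> v), v)) has_derivative
         (\<lambda>h. (v \<bullet> h / sqrt (1 + v \<bullet> v), h))) (at v)"
    by (rule derivative_eq_intros refl p | simp add: inner_commute p divide_simps)+
  thus ?thesis
    by (simp add: hyp_chart_def[abs_def] power2_norm_eq_inner)
qed

lemma hyp_metric_eq: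
  fixes v :: "real ^ 'n"
  shows "hyp_metric v = mat 1 - (\<chi> i j. v $ i * v $ j / (1 + (norm v)\<^sup>2))"
proof -
  have fd: "frechet_derivative hyp_chart (at v) = (\<lambda>h. (v \<bullet> h / sqrt (1 + (norm v)\<^sup>2), h))"
    using frechet_derivative_at[OF has_derivative_hyp_chart[of v]] by simp
  have p: "sqrt (1 + (norm v)\<^sup>2) * sqrt (1 + (norm v)\<^sup>2) = 1 + (norm v)\<^sup>2"
    by simp
  have "(\<Sum>k\<in>UNIV. axis i (1::real) $ k * axis j 1 $ k) = (if i = j then 1 else 0)" for i j :: 'n
    by (simp add: axis_def if_distrib[of "\<lambda>x. _ * x"] cong: if_cong)
  thus ?thesis
    unfolding hyp_metric_def fd mink_def vec_eq_iff
    by (auto simp: inner_axis mat_def p simp del: real_sqrt_mult_self)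
qed

text \<open>
  An orthogonal change of basis that moves \<open>u\<close> to an axis turns the matrix into a diagonal one, with a
  single entry different from \<open>1\<close>.
\<close>

lemma det_id_minus_rank_one:
  fixes u :: "real ^ 'n"
  shows "det (mat 1 - (\<chi> i j. u $ i * u $ j)) = 1 - (norm u)\<^sup>2"
proof -
  obtain k :: 'n where True by blast
  have "norm u = norm (norm u *\<^sub>R axis k (1::real))" by simp
  then obtain f where f: "orthogonal_transformation f" "f u = norm u *\<^sub>R axis k (1::real)"
    by (rule orthogonal_transformation_exists)
  define A where "A = matrix f"
  have lin: "linear f" using f(1) by (rule orthogonal_transformation_linear)
  have oA: "orthogonal_matrix A"
    using f(1) unfolding A_def orthogonal_transformation_matrix by (rule conjunct2)
  have Au: "A *v u = norm u *\<^sub>R axis k (1::real)"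
    using f(2) lin by (simp add: A_def matrix_works)
  let ?D = "mat 1 - (\<chi> i j. u $ i * u $ j) :: real^'n^'n"
  define E where "E = A ** ?D ** transpose A"
  \<comment> \<open>conjugating \<open>u u\<^sup>T\<close> by \<open>A\<close> gives \<open>(A u) (A u)\<^sup>T\<close>, and \<open>A u\<close> has a single nonzero entry\<close>
  have Au_i: "(\<Sum>j\<in>UNIV. A $ i $ j * u $ j) = (if i = k then norm u else 0)" for i
    using arg_cong[OF Au, of "\<lambda>x. x $ i"] by (simp add: matrix_vector_mult_def axis_def)
  have Eeq: "E = mat 1 - A ** (\<chi> i j. u $ i * u $ j) ** transpose A"
  proof -
    have "A ** (M - N) = A ** M - A ** N" "(M - N) ** B = M ** B - N ** B"
      for M N B :: "real^'n^'n"
      by (simp_all add: matrix_matrix_mult_def vec_eq_iff sum_subtractf algebra_simps)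
    thus ?thesis
      using oA unfolding E_def orthogonal_matrix_def by simp
  qed
  have R: "(A ** (\<chi> i j. u $ i * u $ j) ** transpose A) $ i $ j
          = (if i = k then norm u else 0) * (if j = k then norm u else 0)" for i j
  proof -
    have "(A ** (\<chi> i j. u $ i * u $ j) ** transpose A) $ i $ j
        = (\<Sum>b\<in>UNIV. (\<Sum>a\<in>UNIV. A $ i $ a * (u $ a * u $ b)) * A $ j $ b)"
      by (simp add: matrix_matrix_mult_def transpose_def)
    also have "\<dots> = (\<Sum>b\<in>UNIV. (\<Sum>a\<in>UNIV. A $ i $ a * u $ a) * (A $ j $ b * u $ b))"
      by (simp add: sum_distrib_right sum_distrib_left mult_ac)
    also have "\<dots> = (\<Sum>a\<in>UNIV. A $ i $ a * u $ a) * (\<Sum>b\<in>UNIV. A $ j $ b * u $ b)"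
      by (simp add: sum_distrib_left)
    finally show ?thesis by (simp only: Au_i)
  qed
  have "det E = (\<Prod>i\<in>UNIV. E $ i $ i)"
    by (rule det_diagonal) (auto simp: Eeq R mat_def)
  also have "\<dots> = (\<Prod>i\<in>UNIV. if i = k then 1 - (norm u)\<^sup>2 else 1)"
    by (intro prod.cong) (auto simp: Eeq R mat_def power2_eq_square)
  also have "\<dots> = 1 - (norm u)\<^sup>2"
    by (simp add: prod.delta)
  finally have "det E = 1 - (norm u)\<^sup>2" .
  moreover have "det E = det ?D"
    using det_orthogonal_matrix[OF oA] by (auto simp: E_def det_mul)
  ultimately show ?thesis by simp
qed

lemma det_hyp_metric:
  fixes v :: "real ^ 'n"
  shows "det (hyp_metric v) = 1 / (1 + (norm v)\<^sup>2)"
proof -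
  define s where "s = sqrt (1 + (norm v)\<^sup>2)"
  have s: "s > 0" "s * s = 1 + (norm v)\<^sup>2" by (auto simp: s_def add_pos_nonneg)
  have "hyp_metric v = mat 1 - (\<chi> i j. (v /\<^sub>R s) $ i * (v /\<^sub>R s) $ j)"
    unfolding hyp_metric_eq using s by (simp add: vec_eq_iff divide_simps flip: s(2))
  hence "det (hyp_metric v) = 1 - (norm (v /\<^sub>R s))\<^sup>2"
    by (simp only: det_id_minus_rank_one)
  also have "\<dots> = 1 - (norm v)\<^sup>2 / (s * s)"
    using s by (simp add: power2_eq_square divide_simps)
  also have "\<dots> = 1 / (1 + (norm v)\<^sup>2)"
    using add_pos_nonneg[of 1 "(norm v)\<^sup>2"] by (simp add: s(2) divide_simps)
  finally show ?thesis .
qed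

section \<open>Lower bounds for Lebesgue norms\<close>

lemma rec_exp_eq: "p \<noteq> \<infinity> \<Longrightarrow> p \<ge> 1 \<Longrightarrow> rec_exp p = 1 / enn2real p"
  by (cases p) (auto simp: rec_exp_def inverse_ennreal divide_simps ennreal_ge_1)

lemma rec_exp_top [simp]: "rec_exp top = 0"
  by (simp add: rec_exp_def)

lemma enn2real_ge: "p \<noteq> \<infinity> \<Longrightarrow> p \<ge> ennreal c \<Longrightarrow> enn2real p \<ge> c"
  by (metis enn2real_nonneg ennreal_enn2real_if ennreal_le_iff infinity_ennreal_def)

lemma rec_exp_bounds:
  assumes "p \<ge> 1"
  shows "0 \<le> rec_exp p" "rec_exp p \<le> 1"
proof -
  show "0 \<le> rec_exp p" by (simp add: rec_exp_def)
  show "rec_exp p \<le> 1"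
    using assms enn2real_ge[of p 1] rec_exp_eq[of p] by (cases "p = \<infinity>") auto
qed

lemma Lp_norm_ge_powr_integral:
  assumes "q \<noteq> \<infinity>" "q \<ge> 1" "J \<ge> 0"
    and "ennreal J \<le> (\<integral>\<^sup>+ x. ennreal (cmod (F x) powr enn2real q) \<partial>N)"
  shows "ennreal (J powr rec_exp q) \<le> Lp_norm q N F"
proof (cases "(\<integral>\<^sup>+ x. ennreal (cmod (F x) powr enn2real q) \<partial>N) = \<infinity>")
  case True
  thus ?thesis using assms by (simp add: Lp_norm_def)
next
  case False
  define I where "I = enn2real (\<integral>\<^sup>+ x. ennreal (cmod (F x) powr enn2real q) \<partial>N)"
  have "J \<le> I"
    using False assms(3,4) unfolding I_def
    by (metis enn2real_ge infinity_ennreal_def)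
  hence "J powr rec_exp q \<le> I powr rec_exp q"
    using assms rec_exp_bounds[of q] by (intro powr_mono2) auto
  thus ?thesis
    using False assms by (simp add: Lp_norm_def Let_def I_def ennreal_leI)
qed

text \<open>
  The form of Chebyshev's inequality that treats all exponents alike: for \<open>q = \<infinity>\<close> the power of \<open>V\<close>
  is \<open>V powr 0 = 1\<close>, because \<open>V > 0\<close>.
\<close>

lemma Lp_norm_ge_on_set:
  assumes q: "q \<ge> 1" and A: "A \<in> sets N" and V: "V > 0" "ennreal V \<le> emeasure N A"
    and a: "a \<ge> 0" "\<And>x. x \<in> A \<Longrightarrow> a \<le> cmod (F x)"
  shows "ennreal (a * V powr rec_exp q) \<le> Lp_norm q N F"
proof (cases "q = \<infinity>")
  case True
  have "ennreal a \<le> esssup N (\<lambda>x. ennreal (cmod (F x)))"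
  proof (rule ccontr)
    assume "\<not> ?thesis"
    hence less: "esssup N (\<lambda>x. ennreal (cmod (F x))) < ennreal a" by simp
    have "AE x in N. ennreal (cmod (F x)) \<le> esssup N (\<lambda>x. ennreal (cmod (F x)))"
      by (rule esssup_AE)
    hence "AE x in N. x \<notin> A"
    proof (rule eventually_mono)
      fix x assume "ennreal (cmod (F x)) \<le> esssup N (\<lambda>x. ennreal (cmod (F x)))"
      hence "ennreal (cmod (F x)) < ennreal a" using less by order
      thus "x \<notin> A" using a(2)[of x] a(1) by (auto simp: ennreal_less_iff)
    qed
    hence "emeasure N A = 0"
      using A by (simp add: AE_iff_null_sets[symmetric] null_setsD1)
    thus False using V by (simp add: ennreal_eq_0_iff)
  qed
  thus ?thesis using True V by (simp add: Lp_norm_def)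
next
  case False
  let ?q = "enn2real q"
  have q1: "?q \<ge> 1" using enn2real_ge[OF False, of 1] q by simp
  have "ennreal (a powr ?q * V) = ennreal (a powr ?q) * ennreal V"
    using V by (simp add: ennreal_mult)
  also have "\<dots> \<le> ennreal (a powr ?q) * emeasure N A"
    using V by (intro mult_left_mono) auto
  also have "\<dots> = (\<integral>\<^sup>+ x. ennreal (a powr ?q) * indicator A x \<partial>N)"
    using A by (simp add: nn_integral_cmult_indicator)
  also have "\<dots> \<le> (\<integral>\<^sup>+ x. ennreal (cmod (F x) powr ?q) \<partial>N)"
    using a q1 by (intro nn_integral_mono) (auto simp: indicator_def intro!: ennreal_leI powr_mono2)
  finally have "ennreal ((a powr ?q * V) powr rec_exp q) \<le> Lp_norm q N F"
    using False q V by (intro Lp_norm_ge_powr_integral) auto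
  moreover have "(a powr ?q * V) powr rec_exp q = a * V powr rec_exp q"
    using a V q1 rec_exp_eq[OF False q] by (cases "a = 0") (auto simp: powr_mult powr_powr)
  ultimately show ?thesis by simp
qed

lemma Lp_norm_scaled_indicator_le:
  fixes S :: "'a set"
  assumes p: "p \<ge> 1" and S: "S \<in> sets M" "emeasure M S < \<infinity>" "measure M S > 0" and a: "a > 0"
  shows "Lp_norm p M (\<lambda>x. of_real a * indicator S x) \<le> ennreal (a * measure M S powr rec_exp p)"
proof (cases "p = \<infinity>")
  case True
  have "esssup M (\<lambda>x. ennreal (cmod (of_real a * indicator S x))) \<le> ennreal a"
    using S(1) a
    by (intro esssup_I) (auto simp: indicator_def norm_mult intro!: AE_I2)
  thus ?thesis using True S by (simp add: Lp_norm_def)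
next
  case False
  let ?p = "enn2real p"
  have p1: "?p \<ge> 1" using enn2real_ge[OF False, of 1] p by simp
  have "(\<integral>\<^sup>+ x. ennreal (cmod (of_real a * indicator S x) powr ?p) \<partial>M)
      = (\<integral>\<^sup>+ x. ennreal (a powr ?p) * indicator S x \<partial>M)"
    using a by (intro nn_integral_cong) (auto simp: indicator_def norm_mult)
  also have "\<dots> = ennreal (a powr ?p) * emeasure M S"
    using S by (simp add: nn_integral_cmult_indicator)
  also have "\<dots> = ennreal (a powr ?p * measure M S)"
    using S by (simp add: ennreal_mult emeasure_eq_ennreal_measure)
  finally have I: "(\<integral>\<^sup>+ x. ennreal (cmod (of_real a * indicator S x) powr ?p) \<partial>M)
      = ennreal (a powr ?p * measure M S)" .
  have "(a powr ?p * measure M S) powr rec_exp p = a * measure M S powr rec_exp p"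
    using a S p1 rec_exp_eq[OF False p] by (auto simp: powr_mult powr_powr)
  thus ?thesis
    using False I by (simp add: Lp_norm_def Let_def)
qed

section \<open>Boxes and cones around a coordinate axis\<close>

text \<open>
  The sign \<open>s\<close> selects the positive or the negative half of the axis \<open>k\<close>. The range of the
  axial coordinate makes the boxes for \<open>\<alpha> = 1, 2, 4, \<dots>\<close> disjoint, and the width scales with \<open>\<alpha>\<close>, so that
  all of them lie in one cone of aperture \<open>\<eta>\<close>.
\<close>

definition box_along :: "real \<Rightarrow> 'n \<Rightarrow> real \<Rightarrow> real \<Rightarrow> (real ^ 'n) set" where
  "box_along s k \<alpha> \<eta> = {v. \<alpha> < s * v $ k \<and> s * v $ k < 2 * \<alpha> \<and> (\<forall>i. i \<noteq> k \<longrightarrow> \<bar>v $ i\<bar> < \<alpha> * \<eta>)}"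

lemma
  fixes k :: "'n :: finite"
  assumes s: "\<bar>s\<bar> = 1" and pos: "\<alpha> > 0" "\<eta> > 0"
  shows emeasure_box_along:
      "emeasure lborel (box_along s k \<alpha> \<eta>) = ennreal (\<alpha> ^ CARD('n) * (2 * \<eta>) ^ (CARD('n) - 1))"
    and box_along_borel: "box_along s k \<alpha> \<eta> \<in> sets borel"
proof -
  define a :: "real^'n" where "a = (\<chi> i. if i = k then 3/2 * s * \<alpha> - \<alpha> / 2 else - \<alpha> * \<eta>)"
  define b :: "real^'n" where "b = (\<chi> i. if i = k then 3/2 * s * \<alpha> + \<alpha> / 2 else \<alpha> * \<eta>)"
  have s': "s = 1 \<or> s = -1" using s by linarith
  have eq: "box_along s k \<alpha> \<eta> = box a b"
    using s' by (auto simp: box_along_def mem_box_cart a_def b_def abs_less_iff split: if_splits)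
       (smt (verit))+
  show "box_along s k \<alpha> \<eta> \<in> sets borel" by (simp add: eq)
  have le: "a \<bullet> i \<le> b \<bullet> i" if "i \<in> Basis" for i
    using that pos by (auto simp: Basis_vec_def inner_axis a_def b_def)
  have "emeasure lborel (box a b) = ennreal (\<Prod>i\<in>Basis. (b - a) \<bullet> i)"
    using emeasure_lborel_box[OF le] .
  also have "(\<Prod>i\<in>Basis. (b - a) \<bullet> i) = (\<Prod>i\<in>UNIV. (b - a) $ i)"
  proof -
    have B: "(Basis :: (real^'n) set) = (\<lambda>i. axis i 1) ` UNIV"
      by (auto simp: Basis_vec_def)
    have inj: "inj (\<lambda>i::'n. axis i (1::real))"
      by (auto simp: inj_on_def axis_eq_axis)
    show ?thesis
      unfolding B prod.reindex[OF inj] by (simp add: inner_axis)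
  qed
  also have "\<dots> = (\<Prod>i\<in>UNIV. if i = k then \<alpha> else 2 * \<alpha> * \<eta>)"
    by (intro prod.cong) (auto simp: a_def b_def)
  also have "\<dots> = \<alpha> * (2 * \<alpha> * \<eta>) ^ (CARD('n) - 1)"
    by (simp add: prod.If_cases Collect_neg_eq card_Diff_singleton Compl_eq_Diff_UNIV)
  also have "\<dots> = \<alpha> ^ CARD('n) * (2 * \<eta>) ^ (CARD('n) - 1)"
    by (simp add: power_mult_distrib power_eq_if[of \<alpha> "CARD('n)"])
  finally show "emeasure lborel (box_along s k \<alpha> \<eta>) = ennreal (\<alpha> ^ CARD('n) * (2 * \<eta>) ^ (CARD('n) - 1))"
    by (simp add: eq)
qed

lemma norm_box_along_le:
  fixes k :: "'n :: finite"
  assumes s: "\<bar>s\<bar> = 1" and \<eta>: "\<eta> \<le> 1" and v: "v \<in> box_along s k \<alpha> \<eta>"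
  shows "norm v \<le> 2 * real CARD('n) * \<alpha>"
proof -
  have s': "s = 1 \<or> s = -1" using s by linarith
  have "\<alpha> > 0" using v by (auto simp: box_along_def)
  hence "\<alpha> * \<eta> \<le> \<alpha>" using \<eta> by (simp add: mult_left_le)
  have "norm v \<le> (\<Sum>i\<in>UNIV. \<bar>v $ i\<bar>)" by (rule norm_le_l1_cart)
  also have "\<dots> \<le> (\<Sum>i\<in>(UNIV::'n set). 2 * \<alpha>)"
  proof (rule sum_mono)
    fix i :: 'n
    show "\<bar>v $ i\<bar> \<le> 2 * \<alpha>"
    proof (cases "i = k")
      case True
      thus ?thesis using v s' by (auto simp: box_along_def)
    next
      case False
      hence "\<bar>v $ i\<bar> < \<alpha> * \<eta>" using v by (simp add: box_along_def)
      thus ?thesis using \<open>\<alpha> > 0\<close> \<open>\<alpha> * \<eta> \<le> \<alpha>\<close> by linarith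
    qed
  qed
  finally show ?thesis by simp
qed

lemma norm_box_along_ge:
  assumes s: "\<bar>s\<bar> = 1" and v: "v \<in> box_along s k \<alpha> \<eta>"
  shows "norm v \<ge> \<alpha>"
proof -
  have s': "s = 1 \<or> s = -1" using s by linarith
  have "\<alpha> \<le> \<bar>v $ k\<bar>" using v s' by (auto simp: box_along_def)
  also have "\<dots> \<le> norm v" by (rule component_le_norm_cart)
  finally show ?thesis .
qed

text \<open>
  Invariance under positive scaling makes the part of the cone inside the unit ball the preimage of a cap
  under radial projection.
\<close>

definition cone_along :: "'n \<Rightarrow> real \<Rightarrow> (real ^ 'n) set" where
  "cone_along k \<eta> = {x. x $ k > 0 \<and> (\<forall>i. i \<noteq> k \<longrightarrow> \<bar>x $ i\<bar> \<le> \<eta> * x $ k)}"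

lemma box_along_subset_cone:
  assumes "\<bar>s\<bar> = 1" "\<eta> > 0" "v \<in> box_along s k \<alpha> \<eta>"
  shows "s *\<^sub>R v \<in> cone_along k \<eta>"
proof -
  have \<alpha>: "\<alpha> > 0" "\<alpha> < s * v $ k" using assms by (auto simp: box_along_def)
  have "\<bar>v $ i\<bar> \<le> \<eta> * (s * v $ k)" if "i \<noteq> k" for i
  proof -
    have "\<bar>v $ i\<bar> \<le> \<eta> * \<alpha>" using assms that by (auto simp: box_along_def mult.commute less_imp_le)
    also have "\<dots> \<le> \<eta> * (s * v $ k)" using \<alpha> assms by (intro mult_left_mono) auto
    finally show ?thesis .
  qed
  thus ?thesis using \<alpha> assms by (auto simp: cone_along_def abs_mult)
qed

text \<open>
  With \<open>u = d \<eta>\<^sup>2\<close> comparison with the axial coordinates gives \<open>x \<bullet> y \<ge> x\<^sub>k y\<^sub>k (1 - u)\<close> and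
  \<open>\<bar>x\<bar> \<bar>y\<bar> \<le> x\<^sub>k y\<^sub>k (1 + u)\<close>, and \<open>(1 + u) (1 - 2 u) \<le> 1 - u\<close>. The gap is quadratic in \<open>\<eta>\<close>,
  which is why caps of radius of order \<open>\<lambda> powr (- 1 / 2)\<close> suffice for the phase \<open>\<lambda> ln t\<close>.
\<close>

lemma inner_cone_along_ge:
  fixes x y :: "real ^ 'n"
  assumes x: "x \<in> cone_along k \<eta>" and y: "y \<in> cone_along k \<eta>"
    and \<eta>: "\<eta> \<ge> 0" "2 * real CARD('n) * \<eta>\<^sup>2 \<le> 1"
  shows "norm x * norm y * (1 - 2 * real CARD('n) * \<eta>\<^sup>2) \<le> x \<bullet> y"
proof -
  define u where "u = real CARD('n) * \<eta>\<^sup>2"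
  have u: "u \<ge> 0" "2 * u \<le> 1" using \<eta> by (auto simp: u_def)
  have sum_le: "(\<Sum>i\<in>UNIV. f i) \<le> f k + u * c"
    if "\<And>i. i \<noteq> k \<Longrightarrow> f i \<le> \<eta>\<^sup>2 * c" "c \<ge> 0" for f :: "'n \<Rightarrow> real" and c
  proof -
    have "(\<Sum>i\<in>UNIV - {k}. f i) \<le> (\<Sum>i\<in>UNIV - {k}. \<eta>\<^sup>2 * c)"
      using that by (intro sum_mono) auto
    also have "\<dots> \<le> u * c"
      using that(2) by (simp add: u_def card_Diff_singleton mult_right_mono mult.assoc)
    finally show ?thesis by (simp add: sum.remove[of UNIV k])
  qed
  have nrm: "norm z \<le> z $ k * sqrt (1 + u)" if z: "z \<in> cone_along k \<eta>" for z :: "real^'n"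
  proof -
    have "(norm z)\<^sup>2 = (\<Sum>i\<in>UNIV. (z $ i)\<^sup>2)"
      unfolding power2_norm_eq_inner inner_vec_def by (simp add: power2_eq_square)
    also have "\<dots> \<le> (z $ k)\<^sup>2 + u * (z $ k)\<^sup>2"
    proof (rule sum_le)
      fix i assume "i \<noteq> k"
      hence "\<bar>z $ i\<bar> \<le> \<eta> * z $ k" using z by (auto simp: cone_along_def)
      hence "\<bar>z $ i\<bar>\<^sup>2 \<le> (\<eta> * z $ k)\<^sup>2" by (rule power_mono) simp
      thus "(z $ i)\<^sup>2 \<le> \<eta>\<^sup>2 * (z $ k)\<^sup>2" by (simp add: power_mult_distrib)
    qed simp
    also have "\<dots> = (z $ k * sqrt (1 + u))\<^sup>2"
      using u by (simp add: power_mult_distrib algebra_simps)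
    finally show ?thesis
      by (rule power2_le_imp_le) (use u z in \<open>auto simp: cone_along_def\<close>)
  qed
  have pos: "x $ k > 0" "y $ k > 0" using x y by (auto simp: cone_along_def)
  have "norm x * norm y \<le> (x $ k * sqrt (1 + u)) * (y $ k * sqrt (1 + u))"
    using x y pos u by (intro mult_mono nrm) auto
  also have "\<dots> = x $ k * y $ k * (1 + u)" using u by (simp add: algebra_simps)
  finally have "norm x * norm y * (1 - 2 * u) \<le> x $ k * y $ k * (1 + u) * (1 - 2 * u)"
    using u by (intro mult_right_mono) auto
  also have "\<dots> = x $ k * y $ k * ((1 + u) * (1 - 2 * u))" by simp
  also have "\<dots> \<le> x $ k * y $ k * (1 - u)"
    using pos u by (intro mult_left_mono) (auto simp: algebra_simps)
  also have "\<dots> \<le> x \<bullet> y"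
  proof -
    have "(\<Sum>i\<in>UNIV. - (x $ i * y $ i)) \<le> - (x $ k * y $ k) + u * (x $ k * y $ k)"
    proof (rule sum_le)
      fix i assume "i \<noteq> k"
      hence "\<bar>x $ i\<bar> * \<bar>y $ i\<bar> \<le> (\<eta> * x $ k) * (\<eta> * y $ k)"
        using x y pos \<eta> by (intro mult_mono) (auto simp: cone_along_def)
      thus "- (x $ i * y $ i) \<le> \<eta>\<^sup>2 * (x $ k * y $ k)"
        using abs_ge_minus_self[of "x $ i * y $ i"]
        by (simp add: abs_mult power2_eq_square algebra_simps)
    qed (use pos in simp)
    thus ?thesis by (simp add: inner_vec_def sum_negf algebra_simps)
  qed
  finally show ?thesis by (simp only: u_def mult.assoc)
qed

section \<open>Spherical caps\<close>

lemma space_sphere_measure [simp]: "space (sphere_measure :: (real^'n) measure) = sphere 0 1"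
  by (simp add: sphere_measure_def space_scale_measure space_restrict_space)

lemma sets_sphere_measure [simp, measurable_cong]:
  "sets (sphere_measure :: (real^'n) measure) = sets (restrict_space borel (sphere 0 1))"
  by (simp add: sphere_measure_def)

lemma emeasure_sphere_measure:
  fixes S :: "(real^'n) set"
  assumes S: "S \<in> sets sphere_measure"
  shows "emeasure sphere_measure S
    = of_nat CARD('n) * emeasure lborel {x \<in> cball 0 1 - {0}. x /\<^sub>R norm x \<in> S}"
proof -
  let ?R = "restrict_space lborel (cball 0 1 - {0}) :: (real^'n) measure"
  have "(\<lambda>x::real^'n. x /\<^sub>R norm x) \<in> borel_measurable borel" by measurable
  hence "(\<lambda>x. x /\<^sub>R norm x) \<in> measurable ?R (restrict_space borel (sphere 0 1))"
    by (intro measurable_restrict_space2 measurable_restrict_space1)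
       (auto simp: space_restrict_space)
  hence "emeasure sphere_measure S
      = of_nat CARD('n) * emeasure ?R ((\<lambda>x. x /\<^sub>R norm x) -` S \<inter> space ?R)"
    using S by (simp add: sphere_measure_def emeasure_distr)
  also have "emeasure ?R ((\<lambda>x. x /\<^sub>R norm x) -` S \<inter> space ?R)
     = emeasure lborel ((\<lambda>x. x /\<^sub>R norm x) -` S \<inter> space ?R)"
    by (rule emeasure_restrict_space) (auto simp: space_restrict_space)
  also have "(\<lambda>x. x /\<^sub>R norm x) -` S \<inter> space ?R = {x \<in> cball 0 1 - {0}. x /\<^sub>R norm x \<in> S}"
    by (auto simp: space_restrict_space)
  finally show ?thesis .
qed

lemma finite_measure_sphere: "finite_measure (sphere_measure :: (real^'n) measure)"
proof
  have "sphere 0 1 \<in> sets (sphere_measure :: (real^'n) measure)"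
    using sets.top[of "sphere_measure :: (real^'n) measure"] by (simp del: sets_sphere_measure)
  hence "emeasure sphere_measure (sphere 0 1 :: (real^'n) set) \<le> of_nat CARD('n) * emeasure lborel (cball 0 1 :: (real^'n) set)"
    by (subst emeasure_sphere_measure) (auto intro!: mult_left_mono emeasure_mono)
  also have "\<dots> < \<infinity>"
    using emeasure_lborel_cball_finite[of "0 :: real^'n" 1]
    by (simp add: ennreal_mult_less_top of_nat_less_top)
  finally show "emeasure sphere_measure (space (sphere_measure :: (real^'n) measure)) \<noteq> \<infinity>"
    by simp
qed

definition cap :: "'n \<Rightarrow> real \<Rightarrow> (real ^ 'n) set" where
  "cap k \<eta> = sphere 0 1 \<inter> cone_along k \<eta>"

lemma cap_sets [measurable]: "cap k \<eta> \<in> sets (sphere_measure :: (real^'n) measure)"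
proof -
  have "cone_along k \<eta> \<in> sets (borel :: (real^'n) measure)"
    unfolding cone_along_def by measurable
  thus ?thesis by (auto simp: cap_def sets_restrict_space)
qed

text \<open>
  The cone over the cap contains a box of length \<open>1 / (2 d)\<close>, short enough to stay in the unit ball.
\<close>

lemma measure_cap_ge:
  fixes k :: "'n :: finite"
  assumes \<eta>: "0 < \<eta>" "\<eta> \<le> 1"
  shows "measure sphere_measure (cap k \<eta>) \<ge> (\<eta> / real CARD('n)) ^ (CARD('n) - 1) / 2"
proof -
  interpret finite_measure "sphere_measure :: (real^'n) measure" by (rule finite_measure_sphere)
  let ?d = "real CARD('n)"
  define \<alpha> where "\<alpha> = 1 / (2 * ?d)"
  have \<alpha>: "\<alpha> > 0" by (simp add: \<alpha>_def)
  have sub: "box_along 1 k \<alpha> \<eta> \<subseteq> {x \<in> cball 0 1 - {0}. x /\<^sub>R norm x \<in> cap k \<eta>}"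
  proof
    fix x assume x: "x \<in> box_along 1 k \<alpha> \<eta>"
    have "norm x \<le> 1" using norm_box_along_le[OF _ \<eta>(2) x] by (simp add: \<alpha>_def)
    moreover have "norm x > 0" using norm_box_along_ge[OF _ x] \<alpha> by linarith
    moreover have "x \<in> cone_along k \<eta>" using box_along_subset_cone[OF _ \<eta>(1) x] by simp
    hence "x /\<^sub>R norm x \<in> cone_along k \<eta>"
      using \<open>norm x > 0\<close> by (auto simp: cone_along_def field_simps abs_mult)
    ultimately show "x \<in> {x \<in> cball 0 1 - {0}. x /\<^sub>R norm x \<in> cap k \<eta>}"
      by (auto simp: cap_def)
  qed
  have meas: "{x \<in> cball 0 1 - {0}. x /\<^sub>R norm x \<in> cap k \<eta>} \<in> sets lborel"
  proof -
    have "{x \<in> cball 0 1 - {0}. x /\<^sub>R norm x \<in> cap k \<eta>} = (cball 0 1 - {0}) \<inter> cone_along k \<eta>"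
      by (auto simp: cap_def cone_along_def field_simps abs_mult)
    moreover have "cone_along k \<eta> \<in> sets (borel :: (real^'n) measure)"
      unfolding cone_along_def by measurable
    ultimately show ?thesis by simp
  qed
  have "ennreal ((\<eta> / ?d) ^ (CARD('n) - 1) / 2) = ennreal (?d * (\<alpha> ^ CARD('n) * (2 * \<eta>) ^ (CARD('n) - 1)))"
  proof -
    have "(\<eta> / D) ^ m / 2 = D * ((1 / (2 * D)) ^ Suc m * (2 * \<eta>) ^ m)" if "D > 0" for D :: real and m
      using that by (simp add: power_divide power_mult_distrib)
    from this[of ?d "CARD('n) - 1"] show ?thesis by (simp add: \<alpha>_def)
  qed
  also have "\<dots> = of_nat CARD('n) * emeasure lborel (box_along 1 k \<alpha> \<eta>)"
    using \<alpha> \<eta> by (simp add: emeasure_box_along ennreal_mult ennreal_of_nat_eq_real_of_nat)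
  also have "\<dots> \<le> emeasure sphere_measure (cap k \<eta>)"
    unfolding emeasure_sphere_measure[OF cap_sets]
    by (intro mult_left_mono emeasure_mono sub meas) simp
  finally show ?thesis
    by (simp add: emeasure_eq_measure)
qed

lemma cap_measure_pos:
  fixes k :: "'n :: finite"
  assumes "0 < \<eta>" "\<eta> \<le> 1"
  shows "measure sphere_measure (cap k \<eta>) > 0"
  by (rule order.strict_trans2[OF _ measure_cap_ge[OF assms]]) (use assms in simp)

lemma emeasure_sphere_measure_finite: "emeasure (sphere_measure :: (real^'n) measure) S < \<infinity>"
  using finite_measure.emeasure_finite[OF finite_measure_sphere] by (simp add: less_top)

lemma measure_sphere_pos: "measure sphere_measure (sphere 0 1 :: (real^'n) set) > 0"
proof -
  interpret finite_measure "sphere_measure :: (real^'n) measure" by (rule finite_measure_sphere)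
  obtain k :: 'n where True by blast
  have "0 < (1 / real CARD('n)) ^ (CARD('n) - 1) / 2" by simp
  also have "\<dots> \<le> measure sphere_measure (cap k 1)" using measure_cap_ge[of 1 k] by simp
  also have "\<dots> \<le> measure sphere_measure (sphere 0 1 :: (real^'n) set)"
    using finite_measure_mono[of "cap k 1" "space sphere_measure"] sets.top[of "sphere_measure :: (real^'n) measure"]
    by (auto simp: cap_def simp del: sets_sphere_measure)
  finally show ?thesis .
qed

section \<open>Integration over hyperbolic space\<close>

lemma hyp_chart_in_hyp_space: "hyp_chart v \<in> hyp_space"
proof -
  have "(\<Sum>i\<in>UNIV. v $ i * v $ i) = (norm v)\<^sup>2"
    by (simp add: power2_norm_eq_inner inner_vec_def)
  thus ?thesis
    by (simp add: hyp_space_def hyp_chart_def mink_def add_pos_nonneg)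
qed

lemma snd_hyp_chart [simp]: "snd (hyp_chart v) = v"
  by (simp add: hyp_chart_def)

lemma hyp_space_eq_hyp_chart:
  assumes "x \<in> hyp_space"
  shows "hyp_chart (snd x) = x"
proof -
  have "(\<Sum>i\<in>UNIV. snd x $ i * snd x $ i) = (norm (snd x))\<^sup>2"
    by (simp add: power2_norm_eq_inner inner_vec_def)
  hence "(fst x)\<^sup>2 = 1 + (norm (snd x))\<^sup>2" "fst x > 0"
    using assms by (auto simp: hyp_space_def mink_def power2_eq_square)
  hence "sqrt (1 + (norm (snd x))\<^sup>2) = fst x"
    by (metis real_sqrt_unique less_imp_le)
  thus ?thesis by (simp add: hyp_chart_def)
qed

lemma hyp_chart_measurable: "hyp_chart \<in> measurable borel (restrict_space borel hyp_space)"
proof (rule measurable_restrict_space2)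
  show "hyp_chart \<in> borel_measurable borel"
    unfolding hyp_chart_def[abs_def]
    by (intro borel_measurable_continuous_onI continuous_intros)
qed (auto simp: hyp_chart_in_hyp_space)

lemma space_hyp_measure [simp]: "space hyp_measure = hyp_space"
  by (simp add: hyp_measure_def space_restrict_space)

lemma sets_hyp_measure [simp, measurable_cong]:
  "sets hyp_measure = sets (restrict_space borel hyp_space)"
  by (simp add: hyp_measure_def)

text \<open>
  The extension operator is estimated on boxes of the chart, hence through a minorant given there.
\<close>

lemma nn_integral_hyp_measure_ge:
  fixes h :: "real^'n \<Rightarrow> ennreal"
  assumes h: "h \<in> borel_measurable borel" and le: "\<And>v. h v \<le> F (hyp_chart v)"
  shows "(\<integral>\<^sup>+ v. ennreal (1 / sqrt (1 + (norm v)\<^sup>2)) * h v \<partial>lborel) \<le> (\<integral>\<^sup>+ x. F x \<partial>hyp_measure)"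
proof -
  have "snd \<in> borel_measurable (borel :: (real \<times> (real^'n)) measure)"
    by (intro borel_measurable_continuous_onI continuous_intros)
  from measurable_compose[OF this h]
  have [measurable]: "(\<lambda>x. h (snd x)) \<in> borel_measurable (restrict_space borel hyp_space)"
    by (rule measurable_restrict_space1)
  note h[measurable]
  have m: "hyp_chart \<in> measurable (density lborel (\<lambda>v. ennreal (sqrt (det (hyp_metric v)))))
      (restrict_space borel hyp_space)"
    using hyp_chart_measurable by simp
  have "(\<integral>\<^sup>+ v. ennreal (1 / sqrt (1 + (norm v)\<^sup>2)) * h v \<partial>lborel)
      = (\<integral>\<^sup>+ v. h (snd (hyp_chart v)) \<partial>density lborel (\<lambda>v. ennreal (sqrt (det (hyp_metric v)))))"
    by (simp add: det_hyp_metric hyp_chart_def real_sqrt_divide nn_integral_density)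
  also have "\<dots> = (\<integral>\<^sup>+ x. h (snd x) \<partial>hyp_measure)"
    unfolding hyp_measure_def by (rule nn_integral_distr[symmetric, OF m]) measurable
  also have "\<dots> \<le> (\<integral>\<^sup>+ x. F x \<partial>hyp_measure)"
  proof (rule nn_integral_mono)
    fix x :: "real \<times> (real^'n)" assume "x \<in> space hyp_measure"
    hence "hyp_chart (snd x) = x" by (simp add: hyp_space_eq_hyp_chart)
    thus "h (snd x) \<le> F x" using le[of "snd x"] by simp
  qed
  finally show ?thesis .
qed

lemma inverse_sqrt_norm_box_ge:
  fixes k :: "'n :: finite"
  assumes s: "\<bar>s\<bar> = 1" and \<eta>: "\<eta> \<le> 1" and v: "v \<in> box_along s k \<alpha> \<eta>"
  shows "1 / (1 + 2 * real CARD('n) * \<alpha>) \<le> 1 / sqrt (1 + (norm v)\<^sup>2)"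
proof -
  have "sqrt (1 + (norm v)\<^sup>2) \<le> 1 + norm v"
    by (rule real_le_lsqrt) (auto simp: power2_eq_square algebra_simps)
  also have "\<dots> \<le> 1 + 2 * real CARD('n) * \<alpha>"
    using norm_box_along_le[OF assms] by simp
  finally have le: "sqrt (1 + (norm v)\<^sup>2) \<le> 1 + 2 * real CARD('n) * \<alpha>" .
  have pos: "sqrt (1 + (norm v)\<^sup>2) > 0" by (simp add: add_pos_nonneg)
  show ?thesis
    using le by (intro divide_left_mono mult_pos_pos order.strict_trans2[OF pos le] pos) auto
qed

lemma nn_integral_box_ge:
  fixes k :: "'n :: finite"
  assumes s: "\<bar>s\<bar> = 1" and \<eta>: "0 < \<eta>" "\<eta> \<le> 1" and \<alpha>: "\<alpha> > 0"
  shows "ennreal (\<alpha> ^ CARD('n) * (2 * \<eta>) ^ (CARD('n) - 1) / (1 + 2 * real CARD('n) * \<alpha>))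
     \<le> (\<integral>\<^sup>+ v. ennreal (1 / sqrt (1 + (norm v)\<^sup>2)) * indicator (box_along s k \<alpha> \<eta>) v \<partial>lborel)"
proof -
  let ?D = "1 + 2 * real CARD('n) * \<alpha>"
  have D: "?D > 0" using \<alpha> by (simp add: add_pos_nonneg)
  have "ennreal (\<alpha> ^ CARD('n) * (2 * \<eta>) ^ (CARD('n) - 1) / ?D)
     = ennreal (1 / ?D) * emeasure lborel (box_along s k \<alpha> \<eta>)"
    using s \<eta> \<alpha> D by (simp add: emeasure_box_along flip: ennreal_mult)
  also have "\<dots> = (\<integral>\<^sup>+ v. ennreal (1 / ?D) * indicator (box_along s k \<alpha> \<eta>) v \<partial>lborel)"
    using box_along_borel[OF s \<alpha> \<eta>(1), of k] by (simp add: nn_integral_cmult_indicator)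
  also have "\<dots> \<le> (\<integral>\<^sup>+ v. ennreal (1 / sqrt (1 + (norm v)\<^sup>2)) * indicator (box_along s k \<alpha> \<eta>) v \<partial>lborel)"
    using inverse_sqrt_norm_box_ge[OF s \<eta>(2)]
    by (intro nn_integral_mono) (auto simp: indicator_def intro!: ennreal_leI)
  finally show ?thesis .
qed

lemma Lp_norm_hyp_box_ge:
  fixes k :: "'n :: finite"
  assumes q: "q \<ge> 1" and s: "\<bar>s\<bar> = 1" and \<eta>: "0 < \<eta>" "\<eta> \<le> 1" and \<alpha>: "\<alpha> > 0"
    and a: "a \<ge> 0" "\<And>v. v \<in> box_along s k \<alpha> \<eta> \<Longrightarrow> a \<le> cmod (F (hyp_chart v))"
  shows "ennreal (a * (\<alpha> ^ CARD('n) * (2 * \<eta>) ^ (CARD('n) - 1) / (1 + 2 * real CARD('n) * \<alpha>)) powr rec_exp q)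
     \<le> Lp_norm q hyp_measure F"
proof -
  let ?B = "box_along s k \<alpha> \<eta>"
  let ?A = "{x \<in> hyp_space. snd x \<in> ?B}"
  have B: "?B \<in> sets borel" using s \<alpha> \<eta>(1) by (rule box_along_borel)
  have "snd \<in> borel_measurable (borel :: (real \<times> (real^'n)) measure)"
    by (intro borel_measurable_continuous_onI continuous_intros)
  from measurable_sets[OF this B] have "snd -` ?B \<in> sets (borel :: (real \<times> (real^'n)) measure)"
    by simp
  moreover have "?A = hyp_space \<inter> snd -` ?B" by auto
  ultimately have A: "?A \<in> sets hyp_measure"
    by (auto simp: sets_restrict_space)
  show ?thesis
  proof (rule Lp_norm_ge_on_set[OF q A])
    show "0 < \<alpha> ^ CARD('n) * (2 * \<eta>) ^ (CARD('n) - 1) / (1 + 2 * real CARD('n) * \<alpha>)"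
      using \<alpha> \<eta> by (auto intro!: divide_pos_pos mult_pos_pos add_pos_pos)
    have "ennreal (\<alpha> ^ CARD('n) * (2 * \<eta>) ^ (CARD('n) - 1) / (1 + 2 * real CARD('n) * \<alpha>))
        \<le> (\<integral>\<^sup>+ v. ennreal (1 / sqrt (1 + (norm v)\<^sup>2)) * indicator ?B v \<partial>lborel)"
      using s \<eta> \<alpha> by (rule nn_integral_box_ge)
    also have "\<dots> \<le> (\<integral>\<^sup>+ x. indicator ?A x \<partial>hyp_measure)"
      using B by (intro nn_integral_hyp_measure_ge)
        (auto simp: indicator_def hyp_chart_in_hyp_space)
    also have "\<dots> = emeasure hyp_measure ?A" using A by simp
    finally show "ennreal (\<alpha> ^ CARD('n) * (2 * \<eta>) ^ (CARD('n) - 1) / (1 + 2 * real CARD('n) * \<alpha>))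
        \<le> emeasure hyp_measure ?A" .
    show "a \<le> cmod (F x)" if "x \<in> ?A" for x
      using a(2)[of "snd x"] that by (simp add: hyp_space_eq_hyp_chart)
  qed fact
qed

text \<open>
  The shell at distance \<open>2 ^ j\<close> has Euclidean volume of order \<open>2 ^ (j d)\<close> and density of order
  \<open>2 ^ (- j)\<close>, so its hyperbolic volume grows like \<open>2 ^ (j (d - 1))\<close>.
\<close>

lemma nn_integral_hyp_shells_ge:
  fixes k :: "'n :: finite"
  assumes s: "\<bar>s\<bar> = 1" and \<eta>: "0 < \<eta>" "\<eta> \<le> 1"
    and b: "\<And>j. b j \<ge> 0"
      "\<And>j v. v \<in> box_along s k (2 ^ j) \<eta> \<Longrightarrow> ennreal (b j) \<le> F (hyp_chart v)"
  shows "(\<Sum>j. ennreal (b j * ((2 ^ j) ^ (CARD('n) - 1) * (2 * \<eta>) ^ (CARD('n) - 1) / (3 * real CARD('n)))))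
     \<le> (\<integral>\<^sup>+ x. F x \<partial>hyp_measure)"
proof -
  let ?B = "\<lambda>j. box_along s k (2 ^ j) \<eta>"
  define h where "h v = (\<Sum>j. ennreal (b j) * indicator (?B j) v)" for v
  have B [measurable]: "?B j \<in> sets borel" for j
    using s \<eta> by (intro box_along_borel) auto
  \<comment> \<open>at each point at most one term of the series defining \<open>h\<close> is nonzero\<close>
  have disj: "i = j" if "v \<in> ?B i" "v \<in> ?B j" for v i j
  proof -
    have "(2::real) ^ i < 2 * 2 ^ j" "(2::real) ^ j < 2 * 2 ^ i"
      using that by (auto simp: box_along_def)
    hence "(2::real) ^ i < 2 ^ Suc j" "(2::real) ^ j < 2 ^ Suc i" by simp_all
    hence "i < Suc j" "j < Suc i"
      using power_less_imp_less_exp[of "2::real"] one_less_numeral_iff semiring_norm(76) by blast+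
    thus ?thesis by simp
  qed
  have hF: "h v \<le> F (hyp_chart v)" for v
  proof (cases "\<exists>i. v \<in> ?B i")
    case True
    then obtain i where i: "v \<in> ?B i" by blast
    have "(\<lambda>j. ennreal (b j) * indicator (?B j) v) = (\<lambda>j. if j = i then ennreal (b j) else 0)"
    proof (rule ext)
      fix j
      show "ennreal (b j) * indicator (?B j) v = (if j = i then ennreal (b j) else 0)"
      proof (cases "j = i")
        case False
        hence "v \<notin> ?B j" using disj[OF i, of j] by metis
        thus ?thesis using False by simp
      qed (use i in simp)
    qed
    hence "h v = ennreal (b i)"
      unfolding h_def using sums_unique[OF sums_single[of i "\<lambda>j. ennreal (b j)"]] by simp
    thus ?thesis using b(2)[OF i] by simp
  next
    case False
    hence "h v = 0" by (simp add: h_def)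
    thus ?thesis by simp
  qed
  have shell: "ennreal (b j * ((2 ^ j) ^ (CARD('n) - 1) * (2 * \<eta>) ^ (CARD('n) - 1) / (3 * real CARD('n))))
     \<le> ennreal (b j) * (\<integral>\<^sup>+ v. ennreal (1 / sqrt (1 + (norm v)\<^sup>2)) * indicator (?B j) v \<partial>lborel)" for j
  proof -
    let ?N = "CARD('n)"
    have "1 + 2 * real ?N * 2 ^ j \<le> 3 * real ?N * 2 ^ j"
    proof -
      have "1 * 1 \<le> real ?N * 2 ^ j" by (intro mult_mono) (auto simp: Suc_leI)
      thus ?thesis by simp
    qed
    hence "(2 ^ j) ^ ?N * (2 * \<eta>) ^ (?N - 1) / (3 * real ?N * 2 ^ j)
       \<le> (2 ^ j) ^ ?N * (2 * \<eta>) ^ (?N - 1) / (1 + 2 * real ?N * 2 ^ j)"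
      using \<eta> by (intro divide_left_mono) (auto intro!: mult_pos_pos add_pos_pos)
    moreover have "((2::real) ^ j) ^ ?N = 2 ^ j * (2 ^ j) ^ (?N - 1)"
      by (simp add: power_eq_if)
    ultimately have "(2 ^ j) ^ (?N - 1) * (2 * \<eta>) ^ (?N - 1) / (3 * real ?N)
       \<le> (2 ^ j) ^ ?N * (2 * \<eta>) ^ (?N - 1) / (1 + 2 * real ?N * 2 ^ j)"
      by (simp add: field_simps)
    hence "ennreal ((2 ^ j) ^ (?N - 1) * (2 * \<eta>) ^ (?N - 1) / (3 * real ?N))
       \<le> (\<integral>\<^sup>+ v. ennreal (1 / sqrt (1 + (norm v)\<^sup>2)) * indicator (?B j) v \<partial>lborel)"
      using nn_integral_box_ge[OF s \<eta>, of "2 ^ j" k] by (auto intro: order.trans ennreal_leI)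
    thus ?thesis
      using b(1)[of j] \<eta> by (subst ennreal_mult) (auto intro: mult_left_mono)
  qed
  have "(\<Sum>j. ennreal (b j * ((2 ^ j) ^ (CARD('n) - 1) * (2 * \<eta>) ^ (CARD('n) - 1) / (3 * real CARD('n)))))
     \<le> (\<Sum>j. ennreal (b j) * (\<integral>\<^sup>+ v. ennreal (1 / sqrt (1 + (norm v)\<^sup>2)) * indicator (?B j) v \<partial>lborel))"
    by (intro suminf_le shell) auto
  also have "\<dots> = (\<Sum>j. \<integral>\<^sup>+ v. ennreal (1 / sqrt (1 + (norm v)\<^sup>2)) * (ennreal (b j) * indicator (?B j) v) \<partial>lborel)"
    by (intro suminf_cong, subst nn_integral_cmult[symmetric]) (measurable, simp add: mult_ac)
  also have "\<dots> = (\<integral>\<^sup>+ v. ennreal (1 / sqrt (1 + (norm v)\<^sup>2)) * h v \<partial>lborel)"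
  proof -
    have m: "(\<lambda>v. ennreal (1 / sqrt (1 + (norm v)\<^sup>2)) * (ennreal (b j) * indicator (?B j) v))
        \<in> borel_measurable lborel" for j
      by measurable
    show ?thesis
      by (simp only: nn_integral_suminf[OF m, symmetric] ennreal_suminf_cmult h_def)
  qed
  also have "\<dots> \<le> (\<integral>\<^sup>+ x. F x \<partial>hyp_measure)"
    by (intro nn_integral_hyp_measure_ge hF) (unfold h_def, measurable)
  finally show ?thesis .
qed

section \<open>Extensions of indicators without cancellation\<close>

text \<open>
  The Minkowski product of the point with chart coordinate \<open>v\<close> and the light-like vector \<open>(1, w)\<close>; its
  logarithm is the Busemann function of the boundary point \<open>w\<close>.
\<close>

definition light_pairing :: "real ^ 'n \<Rightarrow> real ^ 'n \<Rightarrow> real" where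
  "light_pairing v w = sqrt (1 + (norm v)\<^sup>2) - v \<bullet> w"

lemma light_pairing_ge:
  assumes "norm w = 1"
  shows "light_pairing v w \<ge> sqrt (1 + (norm v)\<^sup>2) - norm v"
  using norm_cauchy_schwarz[of v w] assms by (simp add: light_pairing_def)

lemma sqrt_one_plus_gt: "sqrt (1 + (x::real)\<^sup>2) > x"
  by (rule real_less_rsqrt) simp

lemma light_pairing_pos:
  assumes "norm w = 1"
  shows "light_pairing v w > 0"
  using light_pairing_ge[OF assms, of v] sqrt_one_plus_gt[of "norm v"] by linarith

lemma cnj_hyp_wave:
  fixes v w :: "real^'n"
  assumes "norm w = 1"
  shows "cnj (hyp_wave l w (hyp_chart v))
    = of_real (light_pairing v w powr - rho CARD('n)) * cis (- l * ln (light_pairing v w))"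
proof -
  have m: "mink (hyp_chart v) (1, w) = light_pairing v w"
    by (simp add: mink_def hyp_chart_def light_pairing_def inner_vec_def)
  have "light_pairing v w > 0" using light_pairing_pos[OF assms] .
  thus ?thesis
    unfolding hyp_wave_def m
    by (simp add: powr_def Ln_of_real exp_cnj cis_conv_exp algebra_simps flip: exp_of_real exp_add)
qed

lemma cos_ge_half: "\<bar>x :: real\<bar> \<le> 1 \<Longrightarrow> cos x \<ge> 1 / 2"
proof -
  assume "\<bar>x\<bar> \<le> 1"
  hence "\<bar>x\<bar> \<le> pi / 3" using pi_gt3 by linarith
  hence "cos (pi / 3) \<le> cos \<bar>x\<bar>" using pi_gt3 by (intro cos_monotone_0_pi_le) auto
  thus ?thesis by (simp add: cos_60)
qed

text \<open>
  Rotating the integral by \<open>cis (l ln t0)\<close> leaves integrands of argument at most one radian on \<open>S\<close>, and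
  \<open>cos 1 \<ge> 1/2\<close>; the absolute value dominates the real part.
\<close>

lemma fourier_ext_indicator_ge:
  fixes v :: "real^'n"
  assumes l: "l > 0" and S: "S \<in> sets sphere_measure" and a: "a \<ge> 0" and t0: "t0 > 0" and m: "m \<ge> 0"
    and phase: "\<And>w. w \<in> S \<Longrightarrow> l * \<bar>ln (light_pairing v w) - ln t0\<bar> \<le> 1"
    and amp: "\<And>w. w \<in> S \<Longrightarrow> m \<le> light_pairing v w powr - rho CARD('n)"
  shows "inverse (cmod (harish_chandra_c CARD('n) l)) / measure sphere_measure (sphere 0 1 :: (real^'n) set)
          * (a * measure sphere_measure S * m / 2)
     \<le> cmod (fourier_ext l (\<lambda>w. of_real a * indicator S w) (hyp_chart v))"
proof -
  interpret finite_measure "sphere_measure :: (real^'n) measure" by (rule finite_measure_sphere)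
  let ?r = "rho CARD('n)"
  have r: "?r \<ge> 0" by (simp add: rho_def Suc_leI)
  have Ssub: "S \<subseteq> sphere 0 1" using sets.sets_into_space[OF S] by simp
  define G where "G w = of_real (a * indicator S w * light_pairing v w powr - ?r) * cis (- l * ln (light_pairing v w))" for w
  define B where "B = a * (sqrt (1 + (norm v)\<^sup>2) - norm v) powr - ?r"
  have [measurable]: "indicator S \<in> borel_measurable sphere_measure" using S by simp
  have [measurable]: "light_pairing v \<in> borel_measurable sphere_measure"
    unfolding light_pairing_def[abs_def]
    by (subst measurable_cong_sets[OF sets_sphere_measure refl])
       (rule measurable_restrict_space1, measurable)
  have cis_meas: "(\<lambda>w. cis (f w)) \<in> borel_measurable M" if "f \<in> borel_measurable M"
    for f and M :: "(real^'n) measure"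
    using that by (intro measurable_compose[OF that] borel_measurable_continuous_onI continuous_intros)
  have G_meas: "G \<in> borel_measurable sphere_measure"
    unfolding G_def[abs_def] by (intro borel_measurable_times cis_meas) measurable
  have G_int: "integrable sphere_measure G"
  proof (rule integrable_const_bound[of _ B])
    show "AE w in sphere_measure. cmod (G w) \<le> B"
    proof (rule AE_I2)
      fix w :: "real^'n" assume "w \<in> space sphere_measure"
      hence w: "norm w = 1" by simp
      have "light_pairing v w powr - ?r \<le> (sqrt (1 + (norm v)\<^sup>2) - norm v) powr - ?r"
        using light_pairing_ge[OF w, of v] sqrt_one_plus_gt[of "norm v"] r
        by (intro powr_mono2') auto
      thus "cmod (G w) \<le> B"
        using a by (auto simp: G_def B_def norm_mult indicator_def intro!: mult_left_mono)
    qed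
  qed (rule G_meas)
  have int_eq: "(LINT w|sphere_measure. of_real a * indicator S w * cnj (hyp_wave l w (hyp_chart v)))
      = (LINT w|sphere_measure. G w)"
    by (intro Bochner_Integration.integral_cong refl)
       (simp add: cnj_hyp_wave G_def indicator_def)
  define J where "J = (LINT w|sphere_measure. G w)"
  have "a * measure sphere_measure S * m / 2 = (LINT w|sphere_measure. a * m / 2 * indicator S w)"
    using S Ssub by (simp add: Int_absorb2)
  also have "\<dots> \<le> (LINT w|sphere_measure. Re (cis (l * ln t0) * G w))"
  proof (rule integral_mono)
    show "integrable sphere_measure (\<lambda>w. a * m / 2 * indicator S w)"
      using S by (intro integrable_mult_right integrable_real_indicator) (auto simp: emeasure_eq_measure)
    show "integrable sphere_measure (\<lambda>w. Re (cis (l * ln t0) * G w))"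
      by (intro integrable_Re integrable_mult_right G_int)
    fix w :: "real^'n" assume "w \<in> space sphere_measure"
    have *: "Re (cis (l * ln t0) * G w)
        = a * indicator S w * light_pairing v w powr - ?r * cos (l * (ln t0 - ln (light_pairing v w)))"
    proof -
      have "cis (l * ln t0) * G w = of_real (a * indicator S w * light_pairing v w powr - ?r)
          * (cis (l * ln t0) * cis (- l * ln (light_pairing v w)))"
        by (simp add: G_def)
      also have "cis (l * ln t0) * cis (- l * ln (light_pairing v w)) = cis (l * (ln t0 - ln (light_pairing v w)))"
        by (simp add: cis_mult algebra_simps)
      finally show ?thesis by simp
    qed
    show "a * m / 2 * indicator S w \<le> Re (cis (l * ln t0) * G w)"
    proof (cases "w \<in> S")
      case True
      have "\<bar>l * (ln t0 - ln (light_pairing v w))\<bar> \<le> 1"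
        using phase[OF True] l by (simp add: abs_mult abs_minus_commute)
      hence "1 / 2 \<le> cos (l * (ln t0 - ln (light_pairing v w)))" by (rule cos_ge_half)
      hence c: "m * (1 / 2) \<le> light_pairing v w powr - ?r * cos (l * (ln t0 - ln (light_pairing v w)))"
        using amp[OF True] m by (intro mult_mono) auto
      show ?thesis
        using True mult_left_mono[OF c a] unfolding * by (simp add: mult.assoc)
    next
      case False
      thus ?thesis unfolding * by simp
    qed
  qed
  also have "\<dots> = Re (cis (l * ln t0) * J)"
    using G_int by (simp add: J_def)
  also have "\<dots> \<le> cmod (cis (l * ln t0) * J)" by (rule complex_Re_le_cmod)
  also have "\<dots> = cmod J" by (simp add: norm_mult)
  finally have J: "a * measure sphere_measure S * m / 2 \<le> cmod J" .
  have eq: "cmod (fourier_ext l (\<lambda>w. of_real a * indicator S w) (hyp_chart v))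
     = inverse (cmod (harish_chandra_c CARD('n) l)) / measure sphere_measure (sphere 0 1 :: (real^'n) set) * cmod J"
    unfolding fourier_ext_def int_eq J_def[symmetric]
    using measure_sphere_pos[where 'n='n] by (simp add: norm_mult norm_inverse norm_divide divide_inverse)
  show ?thesis unfolding eq by (intro mult_left_mono J) simp
qed

lemma abs_ln_diff_le:
  fixes t t0 :: real
  assumes t0: "t0 > 0" and e: "e \<le> 1 / 2" "\<bar>t - t0\<bar> \<le> e * t0"
  shows "\<bar>ln t - ln t0\<bar> \<le> 2 * e"
proof -
  define y where "y = t / t0"
  have y: "\<bar>y - 1\<bar> \<le> e"
    using t0 e(2) by (simp add: y_def abs_le_iff field_simps)
  have y2: "y \<ge> 1 / 2" using y e by (simp add: abs_le_iff)
  have "t > 0" using y2 t0 by (simp add: y_def field_simps)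
  hence "ln t - ln t0 = ln y" using t0 by (simp add: y_def ln_div)
  moreover have "ln y \<le> y - 1" using y2 by (intro ln_le_minus_one) auto
  moreover have "- ln y \<le> 2 * e"
  proof -
    have "- ln y = ln (1 / y)" using y2 by (simp add: ln_div)
    also have "\<dots> \<le> 1 / y - 1" using y2 by (intro ln_le_minus_one) auto
    also have "\<dots> = (1 - y) / y" using y2 by (simp add: field_simps)
    also have "\<dots> \<le> 2 * e"
    proof -
      have "1 - y \<le> e" "e \<ge> 0" using y by auto
      moreover have "e * 1 \<le> e * (2 * y)" using y2 \<open>e \<ge> 0\<close> by (intro mult_left_mono) auto
      ultimately have "1 - y \<le> 2 * e * y" by linarith
      thus ?thesis using y2 by (simp add: pos_divide_le_eq)
    qed
    finally show ?thesis .
  qed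
  ultimately show ?thesis using y by auto
qed

section \<open>The three test functions\<close>

definition ext_factor :: "'n::finite itself \<Rightarrow> real \<Rightarrow> real" where
  "ext_factor _ l = inverse (cmod (harish_chandra_c CARD('n) l))
     / measure (sphere_measure :: (real^'n) measure) (sphere 0 1)"

lemma ext_factor_pos: "l > 0 \<Longrightarrow> ext_factor TYPE('n::finite) l > 0"
  using inverse_harish_chandra_c_pos[of l "CARD('n)"] measure_sphere_pos[where 'n='n]
  by (simp add: ext_factor_def Suc_leI del: inverse_positive_iff_positive)

lemma ext_factor_lower:
  "\<exists>C>0. \<forall>l\<ge>1. ext_factor TYPE('n::finite) l \<ge> C * l powr rho CARD('n)"
proof -
  let ?W = "measure (sphere_measure :: (real^'n) measure) (sphere 0 1)"
  have W: "?W > 0" by (rule measure_sphere_pos)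
  have "CARD('n) \<ge> 1" by (simp add: Suc_leI)
  then obtain C where C: "C > 0"
    "\<And>l. l \<ge> 1 \<Longrightarrow> inverse (cmod (harish_chandra_c CARD('n) l)) \<ge> C * l powr rho CARD('n)"
    using inverse_harish_chandra_c_lower by blast
  have "ext_factor TYPE('n) l \<ge> C / ?W * l powr rho CARD('n)" if "l \<ge> 1" for l
    using divide_right_mono[OF C(2)[OF that], of ?W] W by (simp add: ext_factor_def)
  with C(1) W show ?thesis by (intro exI[of _ "C / ?W"]) auto
qed

lemma rho_nonneg: "rho CARD('n::finite) \<ge> 0"
  by (simp add: rho_def Suc_leI)

text \<open>
  Volumes of boxes are powers with natural exponent \<open>d - 1\<close>, amplitudes are real powers with
  exponent \<open>\<rho>\<close>.
\<close>

lemma power_card_minus_one: "x > 0 \<Longrightarrow> x ^ (CARD('n::finite) - 1) = x powr (2 * rho CARD('n))"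
proof -
  have "2 * rho CARD('n) = real (CARD('n) - 1)" by (simp add: rho_def of_nat_diff Suc_leI)
  thus "x > 0 \<Longrightarrow> x ^ (CARD('n) - 1) = x powr (2 * rho CARD('n))"
    by (simp only: powr_realpow)
qed

lemma Knapp_radius:
  assumes l: "l > 0" and \<eta>: "\<eta> = 1 / sqrt (4 * real CARD('n::finite) * (1 + l))"
  shows "0 < \<eta>" "\<eta> \<le> 1"
proof -
  have "real CARD('n) \<ge> 1" by (simp add: Suc_leI)
  hence "1 * 1 \<le> (4 * real CARD('n)) * (1 + l)" using l by (intro mult_mono) linarith+
  hence *: "sqrt (4 * real CARD('n) * (1 + l)) \<ge> 1" by (simp only: real_sqrt_ge_1_iff mult_1)
  show "\<eta> \<le> 1" using * unfolding \<eta> by (subst divide_le_eq_1_pos) linarith+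
  show "0 < \<eta>" unfolding \<eta> using * by (intro divide_pos_pos) linarith+
qed

text \<open>
  The box lies in the cone opposite to the cap. There \<open>t\<close> attains, up to a relative error \<open>e\<close>, its
  maximum \<open>t0 = sqrt (1 + \<bar>v\<bar>\<^sup>2) + \<bar>v\<bar>\<close>; the error is quadratic in \<open>\<eta>\<close> and independent of \<open>\<bar>v\<bar>\<close>,
  and \<open>\<eta>\<close> is chosen to make \<open>2 l e \<le> 1\<close>.
\<close>

lemma fourier_ext_box_opposite_cap_ge:
  fixes k :: "'n :: finite"
  assumes l: "l > 0" and a: "a \<ge> 0" and \<alpha>: "\<alpha> \<ge> 1"
    and \<eta>: "\<eta> = 1 / sqrt (4 * real CARD('n) * (1 + l))"
    and v: "v \<in> box_along (-1) k \<alpha> \<eta>"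
  shows "ext_factor TYPE('n) l *
           (a * measure sphere_measure (cap k \<eta>) * (5 * real CARD('n) * \<alpha>) powr - rho CARD('n) / 2)
     \<le> cmod (fourier_ext l (\<lambda>w. of_real a * indicator (cap k \<eta>) w) (hyp_chart v))"
proof -
  let ?N = "real CARD('n)"
  have N: "?N \<ge> 1" by (simp add: Suc_leI)
  note \<eta>01 = Knapp_radius[OF l \<eta>]
  define e where "e = 2 * ?N * \<eta>\<^sup>2"
  have eta2: "\<eta>\<^sup>2 = 1 / (4 * ?N * (1 + l))"
    using l N by (simp add: \<eta> power_divide)
  have "1 + l > 0" using l by simp
  hence e: "e = 1 / (2 * (1 + l))"
    unfolding e_def eta2 using N by (simp add: divide_simps)
  have e1: "0 \<le> e" "e \<le> 1 / 2" using l by (auto simp: e)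
  let ?s = "norm v"
  have s: "?s \<le> 2 * ?N * \<alpha>" using norm_box_along_le[OF _ \<eta>01(2) v] by simp
  have sq: "sqrt (1 + ?s\<^sup>2) \<le> 1 + ?s"
    by (rule real_le_lsqrt) (auto simp: power2_eq_square algebra_simps)
  define t0 where "t0 = sqrt (1 + ?s\<^sup>2) + ?s"
  have t0: "t0 > 0" "?s \<le> t0" unfolding t0_def by (auto intro: add_pos_nonneg simp: add_pos_nonneg)
  have "1 * 1 \<le> ?N * \<alpha>" using N \<alpha> by (intro mult_mono) auto
  hence t0_le: "t0 \<le> 5 * ?N * \<alpha>" using s sq by (simp add: t0_def)
  have light_pairing: "light_pairing v w \<le> t0" "t0 - light_pairing v w \<le> e * t0" "light_pairing v w > 0" if w: "w \<in> cap k \<eta>" for w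
  proof -
    have w1: "norm w = 1" "w \<in> cone_along k \<eta>" using w by (auto simp: cap_def)
    have "(- v) \<in> cone_along k \<eta>" using box_along_subset_cone[OF _ \<eta>01(1) v] by simp
    from inner_cone_along_ge[OF this w1(2)] have "?s * (1 - e) \<le> - (v \<bullet> w)"
      using w1 e1 \<eta>01(1) by (simp add: e_def)
    moreover have "e * ?s \<le> e * t0" using t0 e1 by (intro mult_left_mono)
    ultimately show "t0 - light_pairing v w \<le> e * t0"
      by (simp add: t0_def light_pairing_def algebra_simps)
    show "light_pairing v w \<le> t0"
      using norm_cauchy_schwarz[of "- v" w] w1 by (simp add: t0_def light_pairing_def)
    show "light_pairing v w > 0" by (rule light_pairing_pos[OF w1(1)])
  qed
  show ?thesis
    unfolding ext_factor_def
  proof (rule fourier_ext_indicator_ge[OF l cap_sets a t0(1)])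
    fix w assume w: "w \<in> cap k \<eta>"
    have "\<bar>ln (light_pairing v w) - ln t0\<bar> \<le> 2 * e"
      using light_pairing[OF w] e1 by (intro abs_ln_diff_le t0) auto
    hence "l * \<bar>ln (light_pairing v w) - ln t0\<bar> \<le> l * (2 * e)"
      using l by (intro mult_left_mono) auto
    also have "\<dots> \<le> 1" using l by (simp add: e field_simps)
    finally show "l * \<bar>ln (light_pairing v w) - ln t0\<bar> \<le> 1" .
    show "(5 * ?N * \<alpha>) powr - rho CARD('n) \<le> light_pairing v w powr - rho CARD('n)"
      using light_pairing[OF w] t0_le rho_nonneg[where 'n='n] by (intro powr_mono2') auto
  qed simp
qed

text \<open>
  The box lies above the cap. There \<open>t\<close> is close to its minimum \<open>t0 = sqrt (1 + \<bar>v\<bar>\<^sup>2) - \<bar>v\<bar>\<close>, which is only of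
  order \<open>1 / R\<close>, while the error \<open>\<bar>v\<bar> \<eta>\<^sup>2\<close> is absolute. It is small relative to \<open>t0\<close> when
  \<open>\<eta>\<close> is a small multiple of \<open>1 / R\<close>; the constant \<open>48 d\<^sup>3\<close> makes the relative error
  \<open>1 / (2 (1 + l))\<close>.
\<close>

lemma fourier_ext_box_over_cap_ge:
  fixes k :: "'n :: finite"
  assumes l: "l > 0" and a: "a \<ge> 0" and R: "R \<ge> 1"
    and \<eta>: "\<eta> = 1 / (R * sqrt (48 * real CARD('n) ^ 3 * (1 + l)))"
    and v: "v \<in> box_along 1 k R \<eta>"
  shows "ext_factor TYPE('n) l *
           (a * measure sphere_measure (cap k \<eta>) * R powr rho CARD('n) / 2)
     \<le> cmod (fourier_ext l (\<lambda>w. of_real a * indicator (cap k \<eta>) w) (hyp_chart v))"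
proof -
  let ?N = "real CARD('n)"
  have N: "?N \<ge> 1" by (simp add: Suc_leI)
  have N3: "?N ^ 3 \<ge> 1" using N by (rule one_le_power)
  have \<eta>0: "\<eta> > 0" using l N R by (simp add: \<eta> add_pos_pos)
  have eta2: "\<eta>\<^sup>2 = 1 / (48 * ?N ^ 3 * (1 + l) * R\<^sup>2)"
    using l N R by (simp add: \<eta> power_divide power_mult_distrib)
  have "1 * 1 \<le> (48 * ?N ^ 3) * (1 + l)" using N3 l by (intro mult_mono) linarith+
  hence "sqrt (48 * ?N ^ 3 * (1 + l)) \<ge> 1" by (simp only: real_sqrt_ge_1_iff mult_1)
  hence "1 * 1 \<le> R * sqrt (48 * ?N ^ 3 * (1 + l))"
    using R by (intro mult_mono) auto
  hence \<eta>1: "\<eta> \<le> 1" unfolding \<eta> by (subst divide_le_eq_1_pos) linarith+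
  define \<delta> where "\<delta> = 2 * ?N * \<eta>\<^sup>2"
  define e where "e = 1 / (2 * (1 + l))"
  let ?s = "norm v"
  have s: "R \<le> ?s" "?s \<le> 2 * ?N * R"
    using norm_box_along_le[OF _ \<eta>1 v] norm_box_along_ge[OF _ v] by simp_all
  have s1: "?s \<ge> 1" using s R by simp
  have "?s\<^sup>2 \<le> (2 * ?N * R)\<^sup>2" using s by (intro power_mono) auto
  hence "\<delta> * (3 * ?s\<^sup>2) \<le> \<delta> * (3 * (2 * ?N * R)\<^sup>2)"
    by (intro mult_left_mono) (auto simp: \<delta>_def)
  also have "\<dots> = e"
  proof -
    have "2 * M * (1 / (48 * M ^ 3 * L * R\<^sup>2)) * (3 * (2 * M * R)\<^sup>2) = 1 / (2 * L)"
      if "M > 0" "L > 0" for M L :: real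
      using that R by (simp add: field_simps power2_eq_square power3_eq_cube)
    from this[of ?N "1 + l"] show ?thesis
      unfolding \<delta>_def e_def eta2 using N l by simp
  qed
  finally have \<delta>e: "\<delta> * (3 * ?s\<^sup>2) \<le> e" .
  have e1: "0 \<le> e" "e \<le> 1 / 2" using l by (auto simp: e_def)
  have "1 * 1 \<le> 3 * ?s\<^sup>2" using s1 by (intro mult_mono) auto
  hence "\<delta> * 1 \<le> \<delta> * (3 * ?s\<^sup>2)" by (intro mult_left_mono) (auto simp: \<delta>_def)
  hence "\<delta> \<le> 1" using \<delta>e e1 by linarith
  moreover have "\<delta> \<ge> 0" by (simp add: \<delta>_def)
  ultimately have \<delta>1: "\<delta> \<le> 1" "\<delta> \<ge> 0" .
  have sq: "sqrt (1 + ?s\<^sup>2) \<le> 1 + ?s" "sqrt (1 + ?s\<^sup>2) \<ge> ?s"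
    by (rule real_le_lsqrt, auto simp: power2_eq_square algebra_simps)
       (rule real_le_rsqrt, simp add: power2_eq_square)
  define t0 where "t0 = sqrt (1 + ?s\<^sup>2) - ?s"
  \<comment> \<open>\<open>t0\<close> is the reciprocal of \<open>sqrt (1 + \<bar>v\<bar>\<^sup>2) + \<bar>v\<bar>\<close>, which lies between \<open>2 R\<close> and \<open>3 \<bar>v\<bar>\<close>\<close>
  have t0_eq: "t0 * (sqrt (1 + ?s\<^sup>2) + ?s) = 1"
    by (simp add: t0_def algebra_simps power2_eq_square)
  have t0: "t0 > 0" using sqrt_one_plus_gt[of ?s] by (simp add: t0_def)
  have "1 \<le> t0 * (3 * ?s)"
    using mult_left_mono[of "sqrt (1 + ?s\<^sup>2) + ?s" "3 * ?s" t0] sq s1 t0 t0_eq by simp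
  hence "?s * 1 \<le> ?s * (t0 * (3 * ?s))" using s1 by (intro mult_left_mono) auto
  hence s_le: "?s \<le> t0 * (3 * ?s\<^sup>2)" by (simp add: power2_eq_square mult_ac)
  have "t0 * (2 * R) \<le> t0 * (sqrt (1 + ?s\<^sup>2) + ?s)"
    using t0 sq s by (intro mult_left_mono) auto
  hence t0_le: "t0 \<le> 1 / (2 * R)" using t0_eq R by (simp add: field_simps)
  have light_pairing: "t0 \<le> light_pairing v w" "light_pairing v w - t0 \<le> e * t0" if w: "w \<in> cap k \<eta>" for w
  proof -
    have w1: "norm w = 1" "w \<in> cone_along k \<eta>" using w by (auto simp: cap_def)
    have "v \<in> cone_along k \<eta>" using box_along_subset_cone[OF _ \<eta>0 v] by simp
    from inner_cone_along_ge[OF this w1(2)] have "?s * (1 - \<delta>) \<le> v \<bullet> w"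
      using w1 \<delta>1 \<eta>0 by (simp add: \<delta>_def)
    hence "light_pairing v w - t0 \<le> \<delta> * ?s" by (simp add: t0_def light_pairing_def algebra_simps)
    also have "\<dots> \<le> \<delta> * (t0 * (3 * ?s\<^sup>2))" using s_le \<delta>1 by (intro mult_left_mono)
    also have "\<dots> = \<delta> * (3 * ?s\<^sup>2) * t0" by simp
    also have "\<dots> \<le> e * t0" using \<delta>e t0 by (intro mult_right_mono) auto
    finally show "light_pairing v w - t0 \<le> e * t0" .
    show "t0 \<le> light_pairing v w" using light_pairing_ge[OF w1(1)] by (simp add: t0_def)
  qed
  show ?thesis
    unfolding ext_factor_def
  proof (rule fourier_ext_indicator_ge[OF l cap_sets a t0])
    fix w assume w: "w \<in> cap k \<eta>"
    have "\<bar>ln (light_pairing v w) - ln t0\<bar> \<le> 2 * e"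
      using light_pairing[OF w] e1 by (intro abs_ln_diff_le t0) auto
    hence "l * \<bar>ln (light_pairing v w) - ln t0\<bar> \<le> l * (2 * e)"
      using l by (intro mult_left_mono) auto
    also have "\<dots> \<le> 1" using l by (simp add: e_def field_simps)
    finally show "l * \<bar>ln (light_pairing v w) - ln t0\<bar> \<le> 1" .
    have "e * t0 \<le> 1 * t0" using e1 t0 by (intro mult_right_mono) auto
    hence "light_pairing v w \<le> 2 * t0" using light_pairing[OF w] by simp
    also have "\<dots> \<le> 1 / R" using t0_le R by (simp add: field_simps)
    finally have "(1 / R) powr - rho CARD('n) \<le> light_pairing v w powr - rho CARD('n)"
      using light_pairing[OF w] t0 rho_nonneg[where 'n='n] by (intro powr_mono2') auto
    thus "R powr rho CARD('n) \<le> light_pairing v w powr - rho CARD('n)"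
      using R by (simp add: powr_divide powr_minus divide_simps)
  qed simp
qed

text \<open>
  At distance at most \<open>1 / (4 l)\<close> from the base point, \<open>t\<close> differs from \<open>1\<close> by at most \<open>1 / (2 l)\<close>.
\<close>

lemma fourier_ext_box_near_origin_ge:
  fixes k :: "'n :: finite"
  assumes l: "l > 1" and a: "a \<ge> 0"
    and v: "v \<in> box_along 1 k (1 / (8 * real CARD('n) * l)) 1"
  shows "ext_factor TYPE('n) l *
           (a * measure sphere_measure (sphere 0 1 :: (real^'n) set) * 2 powr - rho CARD('n) / 2)
     \<le> cmod (fourier_ext l (\<lambda>w. of_real a * indicator (sphere 0 1) w) (hyp_chart v))"
proof -
  let ?N = "real CARD('n)" and ?s = "norm v"
  have N: "?N \<ge> 1" by (simp add: Suc_leI)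
  have s: "?s \<le> 1 / (4 * l)"
    using norm_box_along_le[OF _ _ v] N l by (simp add: field_simps)
  also have "\<dots> \<le> 1 / 4" using l by (simp add: field_simps)
  finally have s4: "?s \<le> 1 / 4" .
  have sq: "sqrt (1 + ?s\<^sup>2) \<le> 1 + ?s" "sqrt (1 + ?s\<^sup>2) \<ge> 1"
    by (rule real_le_lsqrt, auto simp: power2_eq_square algebra_simps)
  have light_pairing: "\<bar>light_pairing v w - 1\<bar> \<le> 2 * ?s * 1" if w: "norm w = 1" for w
  proof -
    have "\<bar>v \<bullet> w\<bar> \<le> ?s" using Cauchy_Schwarz_ineq2[of v w] w by simp
    thus ?thesis using sq unfolding light_pairing_def by linarith
  qed
  have S: "sphere 0 1 \<in> sets (sphere_measure :: (real^'n) measure)"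
    using sets.top[of "sphere_measure :: (real^'n) measure"] by (simp del: sets_sphere_measure)
  show ?thesis
    unfolding ext_factor_def
  proof (rule fourier_ext_indicator_ge[OF _ S a, of l 1])
    fix w :: "real^'n" assume "w \<in> sphere 0 1"
    hence w: "norm w = 1" by simp
    have "\<bar>ln (light_pairing v w) - ln 1\<bar> \<le> 2 * (2 * ?s)"
      using light_pairing[OF w] s4 by (intro abs_ln_diff_le) auto
    hence "l * \<bar>ln (light_pairing v w) - ln 1\<bar> \<le> l * (2 * (2 * ?s))"
      using l by (intro mult_left_mono) auto
    also have "\<dots> \<le> 1" using l s by (simp add: field_simps)
    finally show "l * \<bar>ln (light_pairing v w) - ln 1\<bar> \<le> 1" .
    show "2 powr - rho CARD('n) \<le> light_pairing v w powr - rho CARD('n)"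
      using light_pairing[OF w] s4 rho_nonneg[where 'n='n] by (intro powr_mono2') (auto simp: abs_le_iff)
  qed (use l in auto)
qed

text \<open>
  On the shell of size \<open>2 ^ j\<close> the extension is of order \<open>(2 ^ j) powr - \<rho>\<close>, on a set of volume of order
  \<open>(2 ^ j) powr (2 \<rho>)\<close>. The resulting geometric series diverges exactly for \<open>Q \<le> 2\<close>, provided
  that \<open>\<rho> > 0\<close>.
\<close>

lemma nn_integral_fourier_ext_cap_ge:
  fixes k :: "'n :: finite"
  assumes l: "l > 0" and a: "a > 0" and Q: "Q > 0"
    and \<eta>: "\<eta> = 1 / sqrt (4 * real CARD('n) * (1 + l))"
    and B: "B = ext_factor TYPE('n) l * (a * measure sphere_measure (cap k \<eta>) / 2)"
  shows "(\<Sum>j. ennreal ((B * (5 * real CARD('n)) powr - rho CARD('n)) powr Q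
            * ((2 * \<eta>) ^ (CARD('n) - 1) / (3 * real CARD('n)))
            * (2 powr (rho CARD('n) * (2 - Q))) ^ j))
     \<le> (\<integral>\<^sup>+ x. ennreal (cmod (fourier_ext l (\<lambda>w. of_real a * indicator (cap k \<eta>) w) x) powr Q) \<partial>hyp_measure)"
proof -
  let ?N = "real CARD('n)" and ?r = "rho CARD('n)"
  have N: "?N \<ge> 1" by (simp add: Suc_leI)
  note \<eta>0 = Knapp_radius(1)[OF l \<eta>] and \<eta>1 = Knapp_radius(2)[OF l \<eta>]
  have "measure sphere_measure (cap k \<eta>) > 0"
    by (rule cap_measure_pos[OF \<eta>0 \<eta>1])
  hence B0: "B > 0" using ext_factor_pos[OF l, where 'n='n] a by (simp add: B)
  define b where "b j = (B * (5 * ?N * 2 ^ j) powr - ?r) powr Q" for j :: nat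
  have "(\<Sum>j. ennreal (b j * ((2 ^ j) ^ (CARD('n) - 1) * (2 * \<eta>) ^ (CARD('n) - 1) / (3 * ?N))))
     \<le> (\<integral>\<^sup>+ x. ennreal (cmod (fourier_ext l (\<lambda>w. of_real a * indicator (cap k \<eta>) w) x) powr Q) \<partial>hyp_measure)"
  proof (rule nn_integral_hyp_shells_ge[of "-1" \<eta> b k])
    fix j and v :: "real^'n" assume v: "v \<in> box_along (-1) k (2 ^ j) \<eta>"
    have "B * (5 * ?N * 2 ^ j) powr - ?r
       \<le> cmod (fourier_ext l (\<lambda>w. of_real a * indicator (cap k \<eta>) w) (hyp_chart v))"
      using fourier_ext_box_opposite_cap_ge[OF l _ _ \<eta> v, of a] a by (simp add: B mult_ac)
    thus "ennreal (b j) \<le> ennreal (cmod (fourier_ext l (\<lambda>w. of_real a * indicator (cap k \<eta>) w) (hyp_chart v)) powr Q)"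
      unfolding b_def using B0 Q by (intro ennreal_leI powr_mono2) auto
  qed (use \<eta>0 \<eta>1 in \<open>auto simp: b_def\<close>)
  moreover have eq: "b j * ((2 ^ j) ^ (CARD('n) - 1) * (2 * \<eta>) ^ (CARD('n) - 1) / (3 * ?N))
      = (B * (5 * ?N) powr - ?r) powr Q * ((2 * \<eta>) ^ (CARD('n) - 1) / (3 * ?N))
            * (2 powr (?r * (2 - Q))) ^ j" for j
  proof -
    have "b j = ((B * (5 * ?N) powr - ?r) * (2 ^ j) powr - ?r) powr Q"
      using N by (simp add: b_def powr_mult mult.assoc)
    also have "\<dots> = (B * (5 * ?N) powr - ?r) powr Q * (2 ^ j) powr (- ?r * Q)"
      using B0 by (simp add: powr_mult powr_powr)
    finally have bj: "b j = \<dots>" .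
    have "(2 ^ j) powr (- ?r * Q) * (2 ^ j) ^ (CARD('n) - 1) = ((2::real) ^ j) powr (?r * (2 - Q))"
      by (subst power_card_minus_one[where 'n='n]) (simp_all add: algebra_simps flip: powr_add)
    also have "\<dots> = (2 powr (?r * (2 - Q))) ^ j"
      by (simp add: powr_powr powr_realpow[symmetric] mult_ac)
    finally show ?thesis unfolding bj by (simp add: mult_ac)
  qed
  ultimately show ?thesis by (simp only: eq)
qed

section \<open>Unboundedness and norm estimates\<close>

lemma suminf_ennreal_ge_const_eq_top:
  assumes c: "c > 0" and f: "\<And>j. ennreal c \<le> f j"
  shows "(\<Sum>j. f j :: ennreal) = top"
proof -
  have "of_nat n * ennreal c \<le> (\<Sum>j. f j)" for n
  proof -
    have "of_nat n * ennreal c = (\<Sum>j<n. ennreal c)" by simp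
    also have "\<dots> \<le> (\<Sum>j<n. f j)" by (intro sum_mono f)
    also have "\<dots> \<le> (\<Sum>j. f j)" by (intro sum_le_suminf) auto
    finally show ?thesis .
  qed
  hence "(SUP n. of_nat n * ennreal c) \<le> (\<Sum>j. f j)" by (intro SUP_least)
  moreover have "(SUP n. of_nat n * ennreal c) = top * ennreal c"
    by (simp add: SUP_mult_right_ennreal[symmetric] ennreal_SUP_of_nat_eq_top)
  ultimately show ?thesis
    using c by (simp add: ennreal_top_mult top_unique)
qed

text \<open>
  The sum is \<open>D / (1 - 2 powr - y)\<close>, and \<open>1 - 2 powr - y \<le> y ln 2 \<le> y\<close>. Near \<open>y = 0\<close> this is the
  source of the blow-up as \<open>q\<close> tends to \<open>2\<close>.
\<close>

lemma suminf_geometric_ennreal_ge: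
  assumes D: "D \<ge> 0" and y: "y > 0"
  shows "ennreal (D / y) \<le> (\<Sum>j. ennreal (D * (2 powr - y) ^ j))"
proof -
  let ?x = "2 powr - y :: real"
  have x: "0 < ?x" "?x < 1" using y powr_less_mono[of "- y" 0 "2::real"] by auto
  have "- y * ln 2 \<ge> - y * 1"
    using y ln_2_less_1 by (intro mult_left_mono_neg) auto
  hence "1 - y \<le> 1 + - y * ln 2" by simp
  also have "\<dots> \<le> ?x" using exp_ge_add_one_self[of "- y * ln 2"] by (simp add: powr_def)
  finally have "1 - ?x \<le> y" by simp
  hence "D / y \<le> D / (1 - ?x)" using D x y by (intro divide_left_mono) auto
  moreover have "(\<lambda>j. D * ?x ^ j) sums (D * (1 / (1 - ?x)))"
    using x by (intro sums_mult geometric_sums) auto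
  ultimately show ?thesis
    using D x by (subst suminf_ennreal_eq[where x="D * (1 / (1 - ?x))"]) (auto intro: ennreal_leI)
qed

text \<open>
  Constants \<open>\<kappa> \<le> 1\<close> only grow under an exponent \<open>e \<in> [0, 1]\<close>. This keeps the constants in the
  norm estimates independent of the Lebesgue exponents.
\<close>

lemma powr_ge_of_le_one:
  fixes x :: real
  assumes "\<kappa> * l powr - u \<le> x" "0 < \<kappa>" "\<kappa> \<le> 1" "0 \<le> e" "e \<le> 1" "l \<ge> 1"
  shows "\<kappa> * l powr - (u * e) \<le> x powr e"
proof -
  have "\<kappa> powr 1 \<le> \<kappa> powr e" using assms by (intro powr_mono') auto
  hence "\<kappa> * l powr - (u * e) \<le> \<kappa> powr e * (l powr - u) powr e"
    using assms by (simp add: powr_powr mult_right_mono)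
  also have "\<dots> = (\<kappa> * l powr - u) powr e" using assms by (simp add: powr_mult)
  also have "\<dots> \<le> x powr e" using assms by (intro powr_mono2) auto
  finally show ?thesis .
qed

text \<open>
  The \<open>Q\<close>-th root of \<open>1 / (Q - 2)\<close> may be replaced by its square root. With \<open>y = Q - 2\<close> the quotient is
  \<open>y powr (y / (2 Q))\<close>; for \<open>y \<ge> 1\<close> it is at least \<open>1\<close>, and for \<open>y < 1\<close> it is bounded below because
  \<open>y ln y \<ge> - 1\<close>.
\<close>

lemma powr_inverse_exponent_ge:
  fixes Q :: real
  assumes "Q > 2"
  shows "(Q - 2) powr (- 1 / 2) / 2 \<le> (1 / (Q - 2)) powr (1 / Q)"
proof (cases "Q - 2 \<ge> 1")
  case True
  have "(Q - 2) powr (- 1 / 2) / 2 \<le> (Q - 2) powr (- 1 / 2)" by simp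
  also have "\<dots> \<le> (Q - 2) powr - (1 / Q)"
    using True by (intro powr_mono) (auto simp: field_simps)
  also have "\<dots> = (1 / (Q - 2)) powr (1 / Q)"
    using assms by (simp add: powr_divide powr_minus_divide)
  finally show ?thesis .
next
  case False
  define y where "y = Q - 2"
  have y: "0 < y" "y < 1" "Q = y + 2" using assms False by (auto simp: y_def)
  have "ln (1 / y) \<le> 1 / y - 1" using y by (intro ln_le_minus_one) auto
  hence "y * ln y \<ge> y - 1"
    using y by (simp add: ln_div field_simps)
  hence yl: "y * ln y \<ge> - 1" using y by simp
  have "1 / 2 - 1 / Q = y / (2 * Q)" using y by (simp add: field_simps)
  hence "(1 / 2 - 1 / Q) * ln y = (y * ln y) / (2 * Q)" by simp
  also have "\<dots> \<ge> - 1 / (2 * Q)" using y yl by (intro divide_right_mono) auto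
  finally have "(1 / 2 - 1 / Q) * ln y \<ge> - 1 / (2 * Q)" .
  moreover have "- 1 / (2 * Q) \<ge> - 1 / 2" using y by (simp add: field_simps)
  ultimately have "1 / 2 \<le> 1 + (1 / 2 - 1 / Q) * ln y" by linarith
  also have "\<dots> \<le> exp ((1 / 2 - 1 / Q) * ln y)" by (rule exp_ge_add_one_self)
  also have "\<dots> = y powr (1 / 2 - 1 / Q)" using y by (simp add: powr_def)
  finally have "y powr (- 1 / 2) * (1 / 2) \<le> y powr (- 1 / 2) * y powr (1 / 2 - 1 / Q)"
    by (intro mult_left_mono) auto
  also have "\<dots> = y powr - (1 / Q)" by (simp flip: powr_add)
  also have "\<dots> = (1 / y) powr (1 / Q)" using y by (simp add: powr_divide powr_minus_divide)
  finally show ?thesis by (simp add: y_def)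
qed

text \<open>
  The weight is the reciprocal of the \<open>p\<close>-norm of the indicator.
\<close>

lemma Lp_opnorm_ge_indicator:
  assumes p: "p \<ge> 1" and S: "S \<in> sets M" "emeasure M S < \<infinity>" "measure M S > 0"
  shows "Lp_norm q N (T (\<lambda>x. of_real (measure M S powr - rec_exp p) * indicator S x)) \<le> Lp_opnorm p q M N T"
proof -
  let ?f = "\<lambda>x. complex_of_real (measure M S powr - rec_exp p) * indicator S x"
  have "Lp_norm p M ?f \<le> ennreal (measure M S powr - rec_exp p * measure M S powr rec_exp p)"
    using p S by (intro Lp_norm_scaled_indicator_le) auto
  also have "\<dots> = 1" using S by (simp flip: powr_add)
  finally have n: "Lp_norm p M ?f \<le> 1" .
  have "Lp_norm p M ?f < \<infinity>"
    using n by (rule order.strict_trans1) simp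
  moreover have "?f \<in> borel_measurable M" using S by measurable
  ultimately have "?f \<in> {f \<in> Lp_space p M. Lp_norm p M f \<le> 1}"
    using n unfolding Lp_space_def by blast
  thus ?thesis unfolding Lp_opnorm_def by (rule SUP_upper)
qed

lemma indicator_mem_Lp_space:
  assumes "p \<ge> 1" "S \<in> sets M" "emeasure M S < \<infinity>" "measure M S > 0"
  shows "(\<lambda>x. of_real 1 * indicator S x) \<in> Lp_space p M"
proof -
  have "Lp_norm p M (\<lambda>x. of_real 1 * indicator S x) < \<infinity>"
    by (rule order.strict_trans1[OF Lp_norm_scaled_indicator_le[OF assms]]) simp_all
  moreover have "(\<lambda>x. complex_of_real 1 * indicator S x) \<in> borel_measurable M"
    using assms by measurable
  ultimately show ?thesis unfolding Lp_space_def by blast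
qed

text \<open>
  The indicator of a cap belongs to every \<open>L\<^sup>p\<close>, while for \<open>q \<le> 2\<close> the terms of the shell series for its
  extension do not tend to \<open>0\<close>.
\<close>

lemma not_Lp_bounded_of_q_le_2:
  assumes l: "l > 0" and p: "p \<ge> 1" and q: "q \<ge> 1" "q \<le> 2"
  shows "\<not> Lp_bounded p q (sphere_measure :: (real ^ 'n) measure) hyp_measure (fourier_ext l)"
proof
  assume bdd: "Lp_bounded p q (sphere_measure :: (real ^ 'n) measure) hyp_measure (fourier_ext l)"
  obtain k :: 'n where True by blast
  define \<eta> where "\<eta> = 1 / sqrt (4 * real CARD('n) * (1 + l))"
  note \<eta> = Knapp_radius[OF l \<eta>_def]
  let ?f = "\<lambda>w. complex_of_real 1 * indicator (cap k \<eta>) w"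
  define Q where "Q = enn2real q"
  have qfin: "q \<noteq> \<infinity>" using q by (auto simp: top_unique)
  have Q: "0 < Q" "Q \<le> 2"
    using enn2real_ge[OF qfin, of 1] q enn2real_mono[of q 2] by (auto simp: Q_def)
  define B where "B = ext_factor TYPE('n) l * (1 * measure sphere_measure (cap k \<eta>) / 2)"
  define D where "D = (B * (5 * real CARD('n)) powr - rho CARD('n)) powr Q
            * ((2 * \<eta>) ^ (CARD('n) - 1) / (3 * real CARD('n)))"
  have B: "B > 0"
    using ext_factor_pos[OF l, where 'n='n] cap_measure_pos[OF \<eta>, of k] by (simp add: B_def)
  have D: "D > 0" using B \<eta> by (simp add: D_def)
  have "1 \<le> (2 powr (rho CARD('n) * (2 - Q))) ^ j" for j :: nat
    using Q rho_nonneg[where 'n='n] by (intro one_le_power ge_one_powr_ge_zero) auto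
  hence "(\<Sum>j. ennreal (D * (2 powr (rho CARD('n) * (2 - Q))) ^ j)) = top"
    using D by (intro suminf_ennreal_ge_const_eq_top[of D] ennreal_leI) auto
  hence "(\<integral>\<^sup>+ x. ennreal (cmod (fourier_ext l ?f x) powr Q) \<partial>hyp_measure) = top"
    using nn_integral_fourier_ext_cap_ge[OF l _ Q(1) \<eta>_def B_def, unfolded D_def[symmetric]]
    by (simp add: top_unique)
  hence inf: "Lp_norm q hyp_measure (fourier_ext l ?f) = \<infinity>"
    using qfin by (simp add: Lp_norm_def Q_def)
  have "?f \<in> Lp_space p sphere_measure"
    using p cap_sets emeasure_sphere_measure_finite cap_measure_pos[OF \<eta>] by (rule indicator_mem_Lp_space)
  moreover have "fourier_ext l f \<in> Lp_space q hyp_measure"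
    if "f \<in> Lp_space p (sphere_measure :: (real ^ 'n) measure)" for f
    using bdd that unfolding Lp_bounded_def by blast
  ultimately have "fourier_ext l ?f \<in> Lp_space q hyp_measure" by blast
  hence "Lp_norm q hyp_measure (fourier_ext l ?f) < \<infinity>"
    unfolding Lp_space_def by blast
  with inf show False by simp
qed

text \<open>
  For caps of radius of order \<open>1 / R\<close>, boundedness would give
  \<open>\<sigma> R powr \<rho> \<le> C' \<sigma> powr (1 / p)\<close> with \<open>\<sigma>\<close> at least of order \<open>R powr (- 2 \<rho>)\<close>. Hence
  \<open>R powr (\<rho> (2 / p - 1))\<close> would stay bounded, although its exponent is positive.
\<close>

lemma not_Lp_bounded_of_p_less_2:
  assumes n: "CARD('n::finite) \<ge> 2" and l: "l > 0" and p: "p \<ge> 1" "p < 2" and q: "q \<ge> 1"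
  shows "\<not> Lp_bounded p q (sphere_measure :: (real ^ 'n) measure) hyp_measure (fourier_ext l)"
proof
  assume "Lp_bounded p q (sphere_measure :: (real ^ 'n) measure) hyp_measure (fourier_ext l)"
  then obtain C0 where C0: "\<And>f. f \<in> Lp_space p (sphere_measure :: (real ^ 'n) measure) \<Longrightarrow>
      Lp_norm q hyp_measure (fourier_ext l f) \<le> ennreal C0 * Lp_norm p sphere_measure f"
    by (auto simp: Lp_bounded_def)
  define C where "C = max C0 0"
  obtain k :: 'n where True by blast
  let ?N = "real CARD('n)" and ?r = "rho CARD('n)" and ?P = "rec_exp p"
  have r: "?r > 0" using n by (simp add: rho_def)
  have N: "?N \<ge> 1" by (simp add: Suc_leI)
  have pfin: "p \<noteq> \<infinity>" using p by auto
  have P: "1 / 2 < ?P" "?P \<le> 1"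
  proof -
    have "enn2real p < 2" using p pfin by (cases p) (auto simp: ennreal_less_iff simp flip: ennreal_numeral)
    moreover have "enn2real p \<ge> 1" using enn2real_ge[OF pfin, of 1] p by simp
    ultimately show "1 / 2 < ?P" "?P \<le> 1" by (auto simp: rec_exp_eq[OF pfin p(1)] field_simps)
  qed
  define A where "A = sqrt (48 * ?N ^ 3 * (1 + l))"
  have "1 * 1 \<le> (48 * ?N ^ 3) * (1 + l)"
    using one_le_power[OF N, of 3] l by (intro mult_mono) linarith+
  hence A: "A \<ge> 1" unfolding A_def by (simp only: real_sqrt_ge_1_iff mult_1)
  define V0 where "V0 = (2 / A) ^ (CARD('n) - 1) / (3 * ?N)"
  define \<kappa> where "\<kappa> = (1 / (?N * A)) powr (2 * ?r) / 2"
  have V0: "V0 > 0" using A N by (simp add: V0_def)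
  have NA: "?N * A \<ge> 1" using mult_mono[of 1 ?N 1 A] A N by simp
  have \<kappa>: "0 < \<kappa>" "\<kappa> \<le> 1"
  proof -
    have "(1 / (?N * A)) powr (2 * ?r) \<le> 1" using NA r by (intro powr_le1) auto
    thus "\<kappa> \<le> 1" by (simp add: \<kappa>_def)
    show "0 < \<kappa>" using NA by (auto simp: \<kappa>_def)
  qed
  define K where "K = ext_factor TYPE('n) l / 2 * V0 powr rec_exp q * \<kappa>"
  have K: "K > 0" using ext_factor_pos[OF l, where 'n='n] V0 \<kappa> by (simp add: K_def)
  have bound: "K * R powr (?r * (2 * ?P - 1)) \<le> C" if R: "R \<ge> 1" for R
  proof -
    define \<eta> where "\<eta> = 1 / (R * A)"
    have RA: "R * A \<ge> 1" using mult_mono[of 1 R 1 A] A R by simp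
    have \<eta>: "0 < \<eta>" "\<eta> \<le> 1" using RA by (auto simp: \<eta>_def)
    let ?S = "measure sphere_measure (cap k \<eta>)"
    have S: "?S > 0" using cap_measure_pos[OF \<eta>] .
    let ?f = "\<lambda>w. complex_of_real 1 * indicator (cap k \<eta>) w"
    define a where "a = ext_factor TYPE('n) l * (1 * ?S * R powr ?r / 2)"
    have a: "a > 0" using ext_factor_pos[OF l, where 'n='n] S R by (simp add: a_def)
    \<comment> \<open>the growth of the box cancels against \<open>\<eta>\<close> and the density: its volume does not shrink as \<open>R\<close> grows\<close>
    have V: "V0 \<le> R ^ CARD('n) * (2 * \<eta>) ^ (CARD('n) - 1) / (1 + 2 * ?N * R)"
    proof -
      have "1 * 1 \<le> ?N * R" using N R by (intro mult_mono) auto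
      hence le: "1 + 2 * ?N * R \<le> 3 * ?N * R" by (simp only: mult.assoc)
      have "R ^ CARD('n) = R * R ^ (CARD('n) - 1)" by (simp add: power_eq_if)
      moreover have "R ^ (CARD('n) - 1) * (2 * \<eta>) ^ (CARD('n) - 1) = (2 / A) ^ (CARD('n) - 1)"
        using R A by (simp add: \<eta>_def flip: power_mult_distrib)
      ultimately have "R ^ CARD('n) * (2 * \<eta>) ^ (CARD('n) - 1) = R * (2 / A) ^ (CARD('n) - 1)"
        by (simp only: mult.assoc)
      hence "V0 = R ^ CARD('n) * (2 * \<eta>) ^ (CARD('n) - 1) / (3 * ?N * R)"
        using R by (simp only: V0_def) simp
      also have "\<dots> \<le> R ^ CARD('n) * (2 * \<eta>) ^ (CARD('n) - 1) / (1 + 2 * ?N * R)"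
        using R N \<eta> by (intro divide_left_mono le mult_pos_pos add_pos_pos) auto
      finally show ?thesis .
    qed
    have "ennreal (a * V0 powr rec_exp q)
        \<le> ennreal (a * (R ^ CARD('n) * (2 * \<eta>) ^ (CARD('n) - 1) / (1 + 2 * ?N * R)) powr rec_exp q)"
      using a V V0 rec_exp_bounds[OF q] by (intro ennreal_leI mult_left_mono powr_mono2) auto
    also have "\<dots> \<le> Lp_norm q hyp_measure (fourier_ext l ?f)"
    proof (rule Lp_norm_hyp_box_ge[OF q _ \<eta>, of 1])
      show "a \<le> cmod (fourier_ext l ?f (hyp_chart v))" if "v \<in> box_along 1 k R \<eta>" for v
        using fourier_ext_box_over_cap_ge[OF l _ R _ that, of 1] by (simp add: a_def \<eta>_def A_def)
    qed (use a R in auto)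
    also have "\<dots> \<le> ennreal C0 * Lp_norm p sphere_measure ?f"
      using p(1) cap_sets emeasure_sphere_measure_finite S by (intro C0 indicator_mem_Lp_space)
    also have "\<dots> \<le> ennreal C * ennreal (1 * ?S powr ?P)"
      using p(1) cap_sets emeasure_sphere_measure_finite S
      by (intro mult_mono Lp_norm_scaled_indicator_le ennreal_leI) (auto simp: C_def)
    also have "\<dots> = ennreal (C * ?S powr ?P)"
      by (simp add: C_def ennreal_mult)
    finally have "a * V0 powr rec_exp q \<le> C * ?S powr ?P"
      by (subst (asm) ennreal_le_iff) (auto simp: C_def)
    hence "ext_factor TYPE('n) l / 2 * V0 powr rec_exp q * R powr ?r * ?S \<le> C * ?S powr ?P"
      by (simp add: a_def mult_ac)
    moreover have "?S = ?S powr (1 - ?P) * ?S powr ?P" using S by (simp flip: powr_add)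
    ultimately have "ext_factor TYPE('n) l / 2 * V0 powr rec_exp q * R powr ?r * ?S powr (1 - ?P) * ?S powr ?P \<le> C * ?S powr ?P"
      by (simp add: mult.assoc)
    hence le: "ext_factor TYPE('n) l / 2 * V0 powr rec_exp q * R powr ?r * ?S powr (1 - ?P) \<le> C"
      using S by (subst (asm) mult_le_cancel_right_pos) auto
    have "\<kappa> * R powr - (2 * ?r) \<le> ?S"
    proof -
      have "\<kappa> * R powr - (2 * ?r) = (1 / (?N * A) * (1 / R)) powr (2 * ?r) / 2"
        using NA R unfolding powr_mult by (simp add: \<kappa>_def powr_minus_divide powr_divide)
      also have "1 / (?N * A) * (1 / R) = \<eta> / ?N"
        by (simp add: \<eta>_def)
      also have "(\<eta> / ?N) powr (2 * ?r) / 2 = (\<eta> / ?N) ^ (CARD('n) - 1) / 2"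
        using \<eta> N by (simp only: power_card_minus_one[where 'n='n] divide_pos_pos)
      also have "\<dots> \<le> ?S" using \<eta> by (rule measure_cap_ge)
      finally show ?thesis .
    qed
    hence "\<kappa> * R powr - (2 * ?r * (1 - ?P)) \<le> ?S powr (1 - ?P)"
      using \<kappa> P R by (intro powr_ge_of_le_one) auto
    hence "ext_factor TYPE('n) l / 2 * V0 powr rec_exp q * R powr ?r * (\<kappa> * R powr - (2 * ?r * (1 - ?P))) \<le> C"
      using ext_factor_pos[OF l, where 'n='n] by (intro order.trans[OF mult_left_mono le]) auto
    moreover have "R powr ?r * R powr - (2 * ?r * (1 - ?P)) = R powr (?r * (2 * ?P - 1))"
      by (simp add: algebra_simps flip: powr_add)
    ultimately show ?thesis by (simp add: K_def mult_ac)
  qed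
  define s where "s = ?r * (2 * ?P - 1)"
  have s: "s > 0" using r P by (simp add: s_def)
  define R where "R = (C / K + 1) powr (1 / s)"
  have C: "C / K \<ge> 0" using K by (simp add: C_def)
  have "R \<ge> 1" using C s by (simp add: R_def ge_one_powr_ge_zero)
  from bound[OF this] have "K * R powr s \<le> C" by (simp add: s_def)
  moreover have "R powr s = C / K + 1" using C s by (simp add: R_def powr_powr)
  moreover have "K * (C / K + 1) = C + K" using K by (simp add: field_simps)
  ultimately show False using K by simp
qed

text \<open>
  For the normalised indicator of the cap of radius of order \<open>l powr (- 1 / 2)\<close>, the factor in front of the
  integral contributes \<open>l powr \<rho>\<close>, the mass of the cap
  \<open>l powr (- \<rho> (1 - 1 / p))\<close>, and the width of the cone \<open>l powr (- \<rho> / q)\<close>.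
\<close>

lemma opnorm_fourier_ext_Knapp_lower:
  "\<exists>c>0. \<forall>l p q. l > 1 \<and> p \<ge> 1 \<and> q > 2 \<and> q \<noteq> \<infinity> \<longrightarrow>
     ennreal (c * ((enn2real q - 2) powr (- 1 / 2)
        * l powr (rho CARD('n::finite) * rec_exp p - rho CARD('n) * rec_exp q)))
     \<le> Lp_opnorm p q (sphere_measure :: (real ^ 'n) measure) hyp_measure (fourier_ext l)"
proof -
  obtain k :: 'n where True by blast
  let ?N = "real CARD('n)" and ?r = "rho CARD('n)"
  have N: "?N \<ge> 1" by (simp add: Suc_leI)
  have r: "?r \<ge> 0" by (rule rho_nonneg)
  obtain C where C: "C > 0" "\<And>l. l \<ge> 1 \<Longrightarrow> ext_factor TYPE('n) l \<ge> C * l powr ?r"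
    using ext_factor_lower[where 'n='n] by blast
  define \<kappa>1 where "\<kappa>1 = (1 / (8 * ?N ^ 3)) powr ?r / 2"
  define \<kappa>2 where "\<kappa>2 = (1 / (2 * ?N)) powr ?r"
  define \<kappa>3 where "\<kappa>3 = 1 / (3 * ?N * (?r + 1))"
  have N3: "?N ^ 3 \<ge> 1" using N by (rule one_le_power)
  have N3r: "1 * 1 \<le> 3 * ?N * (?r + 1)" using N r by (intro mult_mono) linarith+
  have \<kappa>: "0 < \<kappa>1" "\<kappa>1 \<le> 1" "0 < \<kappa>2" "\<kappa>2 \<le> 1" "0 < \<kappa>3" "\<kappa>3 \<le> 1"
  proof -
    have "1 / (8 * ?N ^ 3) \<le> 1" using N3 by (subst divide_le_eq_1_pos) linarith+
    hence "(1 / (8 * ?N ^ 3)) powr ?r \<le> 1" using r by (intro powr_le1) auto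
    thus "\<kappa>1 \<le> 1" by (simp add: \<kappa>1_def)
    have "1 / (2 * ?N) \<le> 1" using N by (subst divide_le_eq_1_pos) linarith+
    thus "\<kappa>2 \<le> 1" unfolding \<kappa>2_def using r by (intro powr_le1) auto
    show "\<kappa>3 \<le> 1" unfolding \<kappa>3_def using N3r by (subst divide_le_eq_1_pos) linarith+
    show "0 < \<kappa>3" unfolding \<kappa>3_def using N3r by simp
    show "0 < \<kappa>1" "0 < \<kappa>2" using N N3 by (auto simp: \<kappa>1_def \<kappa>2_def)
  qed
  define c where "c = C / 2 * \<kappa>1 * (5 * ?N) powr - ?r * \<kappa>2 * \<kappa>3 / 2"
  have c: "c > 0" using C \<kappa> N by (simp add: c_def)
  have lower: "ennreal (c * ((enn2real q - 2) powr (- 1 / 2) * l powr (?r * rec_exp p - ?r * rec_exp q)))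
     \<le> Lp_opnorm p q (sphere_measure :: (real ^ 'n) measure) hyp_measure (fourier_ext l)"
    if l: "l > 1" and p: "p \<ge> 1" and q: "q > 2" "q \<noteq> \<infinity>" for l :: real and p q :: ennreal
  proof -
    define Q where "Q = enn2real q"
    define P where "P = rec_exp p"
    have q1: "q \<ge> 1" using less_imp_le[OF q(1)] by (rule order.trans[OF one_le_numeral])
    have Q: "Q > 2" unfolding Q_def using q by (cases q) (auto simp: ennreal_less_iff simp flip: ennreal_numeral)
    have recq: "rec_exp q = 1 / Q" using q q1 by (simp add: rec_exp_eq Q_def)
    have P: "0 \<le> P" "P \<le> 1" using rec_exp_bounds[OF p] by (auto simp: P_def)
    have l0: "l > 0" using l by simp
    define \<eta> where "\<eta> = 1 / sqrt (4 * ?N * (1 + l))"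
    note \<eta> = Knapp_radius[OF l0 \<eta>_def]
    have eta2: "\<eta>\<^sup>2 = 1 / (4 * ?N * (1 + l))"
      using l N by (simp add: \<eta>_def power_divide)
    let ?S = "measure sphere_measure (cap k \<eta>)"
    have S: "?S > 0" using cap_measure_pos[OF \<eta>] .
    define a where "a = ?S powr - P"
    have a: "a > 0" using S by (simp add: a_def)
    let ?f = "\<lambda>w. complex_of_real a * indicator (cap k \<eta>) w"
    define B where "B = ext_factor TYPE('n) l * (a * ?S / 2)"
    define X where "X = (2 * \<eta>) ^ (CARD('n) - 1) * \<kappa>3 * (1 / (Q - 2))"
    have B: "B > 0" using ext_factor_pos[OF l0, where 'n='n] S a by (simp add: B_def)
    define D where "D = (B * (5 * ?N) powr - ?r) powr Q * ((2 * \<eta>) ^ (CARD('n) - 1) / (3 * ?N))"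
    have D: "D > 0" using B N \<eta> by (simp add: D_def)
    \<comment> \<open>\<open>\<rho> + 1\<close> instead of \<open>\<rho>\<close> keeps the exponent positive when \<open>d = 1\<close> as well\<close>
    have "ennreal (D / ((?r + 1) * (Q - 2))) \<le> (\<Sum>j. ennreal (D * (2 powr - ((?r + 1) * (Q - 2))) ^ j))"
      using D Q r by (intro suminf_geometric_ennreal_ge) auto
    also have "\<dots> \<le> (\<Sum>j. ennreal (D * (2 powr (?r * (2 - Q))) ^ j))"
    proof (intro suminf_le ennreal_leI mult_left_mono power_mono powr_mono)
      show "- ((?r + 1) * (Q - 2)) \<le> ?r * (2 - Q)" using Q by (simp add: algebra_simps)
    qed (use D in auto)
    also have "\<dots> \<le> (\<integral>\<^sup>+ x. ennreal (cmod (fourier_ext l ?f x) powr Q) \<partial>hyp_measure)"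
      unfolding D_def by (rule nn_integral_fourier_ext_cap_ge[OF l0 a _ \<eta>_def B_def]) (use Q in simp)
    finally have "ennreal ((D / ((?r + 1) * (Q - 2))) powr rec_exp q) \<le> Lp_norm q hyp_measure (fourier_ext l ?f)"
      using q q1 D Q r by (intro Lp_norm_ge_powr_integral) (auto simp: Q_def)
    also have "\<dots> \<le> Lp_opnorm p q (sphere_measure :: (real ^ 'n) measure) hyp_measure (fourier_ext l)"
      unfolding a_def P_def using p cap_sets emeasure_sphere_measure_finite S by (rule Lp_opnorm_ge_indicator)
    finally have op: "ennreal ((D / ((?r + 1) * (Q - 2))) powr rec_exp q)
        \<le> Lp_opnorm p q (sphere_measure :: (real ^ 'n) measure) hyp_measure (fourier_ext l)" .
    \<comment> \<open>the part of \<open>D\<close> that is a \<open>Q\<close>-th power is split off before the \<open>Q\<close>-th root is taken\<close>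
    have "D / ((?r + 1) * (Q - 2)) = (B * (5 * ?N) powr - ?r) powr Q * X"
      by (simp add: D_def X_def \<kappa>3_def)
    hence Deq: "(D / ((?r + 1) * (Q - 2))) powr rec_exp q = B * (5 * ?N) powr - ?r * X powr (1 / Q)"
      using B Q by (simp add: recq powr_mult powr_powr)
    have Xeq: "X powr (1 / Q) = ((2 * \<eta>) ^ (CARD('n) - 1)) powr (1 / Q) * \<kappa>3 powr (1 / Q) * (1 / (Q - 2)) powr (1 / Q)"
      by (simp only: X_def powr_mult)
    have X1: "\<kappa>2 * l powr - (?r * (1 / Q)) \<le> ((2 * \<eta>) ^ (CARD('n) - 1)) powr (1 / Q)"
    proof (rule powr_ge_of_le_one)
      have "\<kappa>2 * l powr - ?r = (1 / (2 * ?N * l)) powr ?r"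
        using l N by (simp add: \<kappa>2_def powr_divide powr_mult powr_minus_divide)
      also have "\<dots> \<le> ((2 * \<eta>)\<^sup>2) powr ?r"
      proof (rule powr_mono2[OF r])
        have "(2 * \<eta>)\<^sup>2 = 1 / (?N * (1 + l))" by (simp add: power_mult_distrib eta2)
        moreover have "?N * (1 + l) \<le> ?N * (2 * l)" using l N by (intro mult_left_mono) auto
        ultimately show "1 / (2 * ?N * l) \<le> (2 * \<eta>)\<^sup>2"
          using l N by (auto intro!: divide_left_mono mult_pos_pos simp: mult_ac)
      qed (use l N in auto)
      also have "\<dots> = (2 * \<eta>) powr (2 * ?r)"
      proof -
        have "(2 * \<eta>)\<^sup>2 = (2 * \<eta>) powr 2" using \<eta> by simp
        thus ?thesis by (simp only: powr_powr)
      qed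
      also have "\<dots> = (2 * \<eta>) ^ (CARD('n) - 1)"
        using \<eta> by (simp only: power_card_minus_one[where 'n='n] mult_pos_pos zero_less_numeral)
      finally show "\<kappa>2 * l powr - ?r \<le> (2 * \<eta>) ^ (CARD('n) - 1)" .
    qed (use \<kappa> Q l in auto)
    have X2: "\<kappa>3 \<le> \<kappa>3 powr (1 / Q)"
      using powr_ge_of_le_one[of \<kappa>3 1 0 \<kappa>3 "1 / Q"] \<kappa> Q by simp
    note X3 = powr_inverse_exponent_ge[OF Q]
    have BC: "C / 2 * \<kappa>1 * l powr (?r * P) \<le> B"
    proof -
      have "\<kappa>1 * l powr - ?r \<le> ?S"
      proof -
        have "\<kappa>1 * l powr - ?r = (1 / (8 * ?N ^ 3 * l)) powr ?r / 2"
          using l N by (simp add: \<kappa>1_def powr_divide powr_mult powr_minus_divide)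
        also have "(1 / (8 * ?N ^ 3 * l)) powr ?r \<le> ((\<eta> / ?N)\<^sup>2) powr ?r"
        proof (rule powr_mono2[OF r])
          have "(\<eta> / ?N)\<^sup>2 = 1 / (4 * ?N ^ 3 * (1 + l))"
            unfolding power_divide eta2 by (simp add: power2_eq_square power3_eq_cube)
          moreover have "4 * ?N ^ 3 * (1 + l) \<le> 4 * ?N ^ 3 * (2 * l)"
            using l N by (intro mult_left_mono) auto
          ultimately show "1 / (8 * ?N ^ 3 * l) \<le> (\<eta> / ?N)\<^sup>2"
            using l N by (auto intro!: divide_left_mono mult_pos_pos simp: mult_ac)
        qed (use l N in auto)
        also have "((\<eta> / ?N)\<^sup>2) powr ?r = (\<eta> / ?N) powr (2 * ?r)"
        proof -
          have "(\<eta> / ?N)\<^sup>2 = (\<eta> / ?N) powr 2" using \<eta> N by simp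
          thus ?thesis by (simp only: powr_powr)
        qed
        also have "\<dots> = (\<eta> / ?N) ^ (CARD('n) - 1)"
          using \<eta> N by (simp only: power_card_minus_one[where 'n='n] divide_pos_pos)
        finally show ?thesis using measure_cap_ge[OF \<eta>, of k] by simp
      qed
      hence "\<kappa>1 * l powr - (?r * (1 - P)) \<le> ?S powr (1 - P)"
        using \<kappa> P l by (intro powr_ge_of_le_one) auto
      also have "\<dots> = a * ?S" using S by (simp add: a_def powr_diff powr_minus_divide)
      finally have aS: "\<kappa>1 * l powr - (?r * (1 - P)) \<le> a * ?S" .
      have "C / 2 * \<kappa>1 * l powr (?r * P) = C * l powr ?r * (\<kappa>1 * l powr - (?r * (1 - P)) / 2)"
      proof -
        have "l powr (?r * P) = l powr ?r * l powr - (?r * (1 - P))"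
          by (simp add: algebra_simps flip: powr_add)
        thus ?thesis by simp
      qed
      also have "\<dots> \<le> B"
        unfolding B_def using aS C(2)[of l] l C(1) \<kappa> ext_factor_pos[OF l0, where 'n='n]
        by (intro mult_mono[OF _ divide_right_mono[OF aS]]) auto
      finally show ?thesis .
    qed
    have "(C / 2 * \<kappa>1 * l powr (?r * P)) * (5 * ?N) powr - ?r
          * ((\<kappa>2 * l powr - (?r * (1 / Q))) * \<kappa>3 * ((Q - 2) powr (- 1 / 2) / 2))
        \<le> (D / ((?r + 1) * (Q - 2))) powr rec_exp q"
      unfolding Deq Xeq using C(1) \<kappa> B
      by (intro mult_mono BC X1 X2 X3 order_refl mult_nonneg_nonneg) simp_all
    moreover have "c * ((Q - 2) powr (- 1 / 2) * l powr (?r * P - ?r * (1 / Q)))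
        = (C / 2 * \<kappa>1 * l powr (?r * P)) * (5 * ?N) powr - ?r
          * ((\<kappa>2 * l powr - (?r * (1 / Q))) * \<kappa>3 * ((Q - 2) powr (- 1 / 2) / 2))"
    proof -
      have "l powr (?r * P - ?r * (1 / Q)) = l powr (?r * P) * l powr - (?r * (1 / Q))"
        by (simp flip: powr_add)
      thus ?thesis by (simp add: c_def)
    qed
    ultimately have "ennreal (c * ((Q - 2) powr (- 1 / 2) * l powr (?r * P - ?r * (1 / Q))))
        \<le> ennreal ((D / ((?r + 1) * (Q - 2))) powr rec_exp q)"
      by (intro ennreal_leI) linarith
    from order.trans[OF this op] show ?thesis
      unfolding recq P_def[symmetric] Q_def[symmetric] .
  qed
  show ?thesis
    by (rule exI[of _ c], rule conjI[OF c], intro allI impI, elim conjE, rule lower; assumption)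
qed

text \<open>
  The normalised constant function, tested on a box of side of order \<open>1 / l\<close> next to the base point.
\<close>

lemma opnorm_fourier_ext_constant_lower:
  "\<exists>c>0. \<forall>l p q. l > 1 \<and> p \<ge> 1 \<and> q \<ge> 1 \<longrightarrow>
     ennreal (c * l powr (rho CARD('n::finite) - real CARD('n) * rec_exp q))
     \<le> Lp_opnorm p q (sphere_measure :: (real ^ 'n) measure) hyp_measure (fourier_ext l)"
proof -
  obtain k :: 'n where True by blast
  let ?N = "real CARD('n)" and ?r = "rho CARD('n)"
  have N: "?N \<ge> 1" by (simp add: Suc_leI)
  obtain C where C: "C > 0" "\<And>l. l \<ge> 1 \<Longrightarrow> ext_factor TYPE('n) l \<ge> C * l powr ?r"
    using ext_factor_lower[where 'n='n] by blast
  let ?W = "measure sphere_measure (sphere 0 1 :: (real^'n) set)"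
  have W: "?W > 0" by (rule measure_sphere_pos)
  have Wset: "sphere 0 1 \<in> sets (sphere_measure :: (real^'n) measure)"
    using sets.top[of "sphere_measure :: (real^'n) measure"] by (simp del: sets_sphere_measure)
  define \<kappa> where "\<kappa> = (1 / (8 * ?N)) ^ CARD('n) / 2"
  have \<kappa>: "0 < \<kappa>" "\<kappa> \<le> 1"
  proof -
    have "1 / (8 * ?N) \<le> 1" using N by (subst divide_le_eq_1_pos) linarith+
    hence "(1 / (8 * ?N)) ^ CARD('n) \<le> 1" by (intro power_le_one) auto
    thus "\<kappa> \<le> 1" by (simp add: \<kappa>_def)
    show "0 < \<kappa>" using N by (simp add: \<kappa>_def)
  qed
  define c where "c = C * (min ?W 1 * 2 powr - ?r / 2) * \<kappa>"
  have c: "c > 0" using C W \<kappa> by (simp add: c_def)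
  have lower: "ennreal (c * l powr (?r - ?N * rec_exp q))
     \<le> Lp_opnorm p q (sphere_measure :: (real ^ 'n) measure) hyp_measure (fourier_ext l)"
    if l: "l > 1" and p: "p \<ge> 1" and q: "q \<ge> 1" for l :: real and p q :: ennreal
  proof -
    define P where "P = rec_exp p"
    have P: "0 \<le> P" "P \<le> 1" using rec_exp_bounds[OF p] by (auto simp: P_def)
    define a where "a = ?W powr - P"
    have a: "a > 0" using W by (simp add: a_def)
    let ?f = "\<lambda>w. complex_of_real a * indicator (sphere (0 :: real^'n) 1) w"
    define \<alpha> where "\<alpha> = 1 / (8 * ?N * l)"
    have \<alpha>: "\<alpha> > 0" using l N by (simp add: \<alpha>_def)
    define b where "b = ext_factor TYPE('n) l * (a * ?W * 2 powr - ?r / 2)"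
    have b: "b > 0" using ext_factor_pos[of l, where 'n='n] l a W by (simp add: b_def)
    define V where "V = \<alpha> ^ CARD('n) * (2 * 1) ^ (CARD('n) - 1) / (1 + 2 * ?N * \<alpha>)"
    have "ennreal (b * V powr rec_exp q) \<le> Lp_norm q hyp_measure (fourier_ext l ?f)"
      unfolding V_def
    proof (rule Lp_norm_hyp_box_ge[where s = 1 and \<eta> = 1 and \<alpha> = \<alpha> and k = k, OF q])
      show "b \<le> cmod (fourier_ext l ?f (hyp_chart v))" if "v \<in> box_along 1 k \<alpha> 1" for v
        using fourier_ext_box_near_origin_ge[OF l _ that[unfolded \<alpha>_def], of a] a by (simp add: b_def)
    qed (use b \<alpha> in auto)
    also have "\<dots> \<le> Lp_opnorm p q (sphere_measure :: (real ^ 'n) measure) hyp_measure (fourier_ext l)"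
      unfolding a_def P_def using p Wset emeasure_sphere_measure_finite W by (rule Lp_opnorm_ge_indicator)
    finally have op: "ennreal (b * V powr rec_exp q)
        \<le> Lp_opnorm p q (sphere_measure :: (real ^ 'n) measure) hyp_measure (fourier_ext l)" .
    have "\<kappa> * l powr - ?N \<le> V"
    proof -
      have "\<kappa> * l powr - ?N = \<alpha> ^ CARD('n) * 1 / 2"
        using l by (simp add: \<kappa>_def \<alpha>_def powr_minus_divide powr_realpow power_divide power_mult_distrib)
      also have "\<dots> \<le> \<alpha> ^ CARD('n) * (2 * 1) ^ (CARD('n) - 1) / 2"
        using \<alpha> by (intro divide_right_mono mult_left_mono one_le_power) auto
      also have "\<dots> \<le> V"
      proof -
        have "2 * ?N * \<alpha> \<le> 1" using l N by (simp add: \<alpha>_def field_simps)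
        thus ?thesis unfolding V_def using \<alpha> N
          by (intro divide_left_mono) (auto intro!: mult_pos_pos add_pos_pos)
      qed
      finally show ?thesis .
    qed
    hence "\<kappa> * l powr - (?N * rec_exp q) \<le> V powr rec_exp q"
      using \<kappa> rec_exp_bounds[OF q] l by (intro powr_ge_of_le_one) auto
    moreover have "C * l powr ?r * (min ?W 1 * 2 powr - ?r / 2) \<le> b"
    proof -
      have "min ?W 1 \<le> ?W powr (1 - P)"
      proof (cases "?W \<ge> 1")
        case True
        thus ?thesis using P by (simp add: ge_one_powr_ge_zero)
      next
        case False
        thus ?thesis using P W powr_mono'[of "1 - P" 1 ?W] by simp
      qed
      also have "\<dots> = a * ?W" using W by (simp add: a_def powr_diff powr_minus_divide)
      finally have "min ?W 1 \<le> a * ?W" .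
      thus ?thesis unfolding b_def
        using C(2)[of l] l C(1) W a ext_factor_pos[of l, where 'n='n]
        by (intro mult_mono divide_right_mono mult_right_mono) auto
    qed
    ultimately have "(C * l powr ?r * (min ?W 1 * 2 powr - ?r / 2)) * (\<kappa> * l powr - (?N * rec_exp q))
       \<le> b * V powr rec_exp q"
      using b \<kappa> C W by (intro mult_mono) auto
    moreover have "c * l powr (?r - ?N * rec_exp q)
        = (C * l powr ?r * (min ?W 1 * 2 powr - ?r / 2)) * (\<kappa> * l powr - (?N * rec_exp q))"
    proof -
      have "l powr (?r - ?N * rec_exp q) = l powr ?r * l powr - (?N * rec_exp q)"
        by (simp flip: powr_add)
      thus ?thesis by (simp add: c_def)
    qed
    ultimately have "ennreal (c * l powr (?r - ?N * rec_exp q)) \<le> ennreal (b * V powr rec_exp q)"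
      by (intro ennreal_leI) linarith
    from order.trans[OF this op] show ?thesis .
  qed
  show ?thesis
    by (rule exI[of _ c], rule conjI[OF c], intro allI impI, elim conjE, rule lower; assumption)
qed

theorem proposition1p3:
  assumes "CARD('n::finite) \<ge> 2"
  shows "(\<forall>(l::real) (p::ennreal) (q::ennreal).
            l > 0 \<and> p \<ge> 1 \<and> q \<ge> 1 \<and> (p < 2 \<or> q \<le> 2) \<longrightarrow>
            \<not> Lp_bounded p q (sphere_measure :: (real ^ 'n) measure) hyp_measure (fourier_ext l)) \<and>
         (\<exists>c::real. c > 0 \<and>
            (\<forall>(l::real) (p::ennreal) (q::ennreal).
               l > 1 \<and> p \<ge> 2 \<and> q > 2 \<longrightarrow>
               Lp_opnorm p q (sphere_measure :: (real ^ 'n) measure) hyp_measure (fourier_ext l)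
               \<ge> ennreal (c *
                   ((if q = \<infinity> then 0 else (enn2real q - 2) powr (- 1 / 2))
                      * l powr (rho CARD('n) * rec_exp p - rho CARD('n) * rec_exp q)
                    + l powr (rho CARD('n) - real CARD('n) * rec_exp q)))))"
proof (rule conjI, goal_cases)
  case 1
  show ?case
  proof (intro allI impI, elim conjE disjE)
    fix l :: real and p q :: ennreal
    assume "l > 0" "p \<ge> 1" "q \<ge> 1" "p < 2"
    thus "\<not> Lp_bounded p q (sphere_measure :: (real ^ 'n) measure) hyp_measure (fourier_ext l)"
      by (intro not_Lp_bounded_of_p_less_2 assms)
  next
    fix l :: real and p q :: ennreal
    assume "l > 0" "p \<ge> 1" "q \<ge> 1" "q \<le> 2"
    thus "\<not> Lp_bounded p q (sphere_measure :: (real ^ 'n) measure) hyp_measure (fourier_ext l)"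
      by (intro not_Lp_bounded_of_q_le_2)
  qed
next
  case 2
  let ?op = "\<lambda>p q l. Lp_opnorm p q (sphere_measure :: (real ^ 'n) measure) hyp_measure (fourier_ext l)"
  let ?K = "\<lambda>l p q. (enn2real q - 2) powr (- 1 / 2)
      * l powr (rho CARD('n) * rec_exp p - rho CARD('n) * rec_exp q)"
  let ?F = "\<lambda>l q. l powr (rho CARD('n) - real CARD('n) * rec_exp q)"
  obtain c1 where c1: "c1 > 0"
    "\<And>l p q. l > 1 \<Longrightarrow> p \<ge> 1 \<Longrightarrow> q > 2 \<Longrightarrow> q \<noteq> \<infinity> \<Longrightarrow> ennreal (c1 * ?K l p q) \<le> ?op p q l"
    using opnorm_fourier_ext_Knapp_lower[where 'n='n] by blast
  obtain c2 where c2: "c2 > 0"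
    "\<And>l p q. l > 1 \<Longrightarrow> p \<ge> 1 \<Longrightarrow> q \<ge> 1 \<Longrightarrow> ennreal (c2 * ?F l q) \<le> ?op p q l"
    using opnorm_fourier_ext_constant_lower[where 'n='n] by blast
  define c where "c = min c1 c2 / 2"
  have c: "c > 0" using c1 c2 by (simp add: c_def)
  have lower: "ennreal (c * ((if q = \<infinity> then 0 else (enn2real q - 2) powr (- 1 / 2))
          * l powr (rho CARD('n) * rec_exp p - rho CARD('n) * rec_exp q) + ?F l q)) \<le> ?op p q l"
    if l: "l > 1" and p: "p \<ge> 2" and q: "q > 2" for l :: real and p q :: ennreal
  proof -
    have p1: "p \<ge> 1" using p by (rule order.trans[OF one_le_numeral])
    have q1: "q \<ge> 1" using less_imp_le[OF q] by (rule order.trans[OF one_le_numeral])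
    define x where "x = (if q = \<infinity> then 0 else (enn2real q - 2) powr (- 1 / 2))
          * l powr (rho CARD('n) * rec_exp p - rho CARD('n) * rec_exp q)"
    have x0: "x \<ge> 0" by (simp add: x_def)
    have "ennreal (c1 * x) \<le> ?op p q l"
      using c1(2)[OF l p1 q] by (cases "q = \<infinity>") (auto simp: x_def)
    moreover have "ennreal (c2 * ?F l q) \<le> ?op p q l" using c2(2)[OF l p1 q1] .
    ultimately have "ennreal (max (c1 * x) (c2 * ?F l q)) \<le> ?op p q l"
      by (auto simp: max_def)
    have "c * (x + ?F l q) \<le> max (c1 * x) (c2 * ?F l q)"
    proof -
      have "min c1 c2 * x \<le> c1 * x" "min c1 c2 * ?F l q \<le> c2 * ?F l q"
        using x0 by (auto intro!: mult_right_mono)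
      thus ?thesis by (simp add: c_def algebra_simps max_def)
    qed
    hence "ennreal (c * (x + ?F l q)) \<le> ennreal (max (c1 * x) (c2 * ?F l q))" by (rule ennreal_leI)
    also have "\<dots> \<le> ?op p q l" by fact
    finally show ?thesis unfolding x_def .
  qed
  show ?case
    by (rule exI[of _ c], rule conjI[OF c], intro allI impI, elim conjE, rule lower; assumption)
qed

end
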